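(* Let $n\in\mathbb{N}\cup\{0\}$, $\tau\in(0,+\infty)$, $d\in\mathbb{N}$, $p\in[2,+\infty)$, $\alpha,\gamma\in(0,1]$, and let $f:[0,(n+1)\tau]\times\mathbb{R}^d\times\mathbb{R}^d\to\mathbb{R}^d$ and $\varphi:[-\tau,0]\to\mathbb{R}^d$ satisfy the following assumptions: (A1) $f(t,\cdot,\cdot)\in C(\mathbb{R}^d\times\mathbb{R}^d;\mathbb{R}^d)$ for all $t\in[0,(n+1)\tau]$, and $\varphi\in C([-\tau,0];\mathbb{R}^d)$; (A2) $f(\cdot,x,z)$ is Borel measurable for all $(x,z)\in\mathbb{R}^d\times\mathbb{R}^d$; (A3') there exists $\bar K\in[0,+\infty)$ such that $|f(t,0,0)|\le\bar K$ for all $t\in[0,(n+1)\tau]$, and there exists $L\in[0,+\infty)$ such that 1. for all $t\in[0,(n+1)\tau]$ and $x_1,x_2,z_1,z_2\in\mathbb{R}^d$, $|f(t,x_1,z_1)-f(t,x_2,z_2)|\le L\bigl(|x_1-x_2|+|z_1-z_2|^{\alpha}\bigr)$; 2. for all $t_1,t_2\in[0,(n+1)\tau]$ and $x,z\in\mathbb{R}^d$, $|f(t_1,x,z)-f(t_2,x,z)|\le L(1+|x|+|z|)|t_1-t_2|^{\gamma}$; 3. for all $s,t\in[-\tau,0]$, $|\varphi(t)-\varphi(s)|\le L|t-s|$. Let $x$ be the unique absolutely continuous solution of $$x'(t)=f(t,x(t),x(t-\tau)),\ t\in[0,(n+1)\tau],\qquad x(t)=\varphi(t),\ t\in[-\tau,0],$$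 and, for each $N\in\mathbb{N}$, let $h=\tau/N$, $t_i^j=j\tau+ih$, and let $y_i^j$ ($j=0,1,\ldots,n$, $i=0,1,\ldots,N$) be the output of the randomized two-stage Runge-Kutta scheme with step size $h$ described in the context. Then there exist $C_{p,0},C_{p,1},\ldots,C_{p,n}\in(0,+\infty)$ such that for all $N\ge\lceil\tau\rceil$ and all $j=0,1,\ldots,n$ $$\Bigl\|\max_{0\le i\le N}|x(t_i^j)-y_i^j|\Bigr\|_p\le C_{p,j}\,h^{\alpha^j\rho},$$ where $\rho:=\frac12+\min\{\gamma,\alpha\}$.
   Context: $|\cdot|$ is the Euclidean norm in $\mathbb{R}^d$; $(\Omega,\Sigma,\mathbb{P})$ is a complete probability space and $\|X\|_p=(\mathbb{E}|X|^p)^{1/p}$ for a random variable $X$. Solutions of the delay differential equation are understood in the Carathéodory sense: $x=\varphi$ on $[-\tau,0]$, $x$ is absolutely continuous on $[0,(n+1)\tau]$, and the equation holds for almost every $t\in[0,(n+1)\tau]$; under the stated assumptions such a solution exists and is unique. Randomized two-stage Runge-Kutta scheme. Let $(\gamma_k^j)_{j\in\mathbb{N}\cup\{0\},\,k\in\mathbb{N}}$ be independent random variables on $\Omega$, each uniformly distributed on $(0,1)$ (not to be confused with the Hölder exponent $\gamma$). For $N\in\mathbb{N}$ put $h=\tau/N$, $t_k^j=j\tau+kh$ for $j=-1,0,\ldots,n$ and $k=0,1,\ldots,N$, and, for $j=0,\ldots,n$ and $k=0,\ldots,N-1$, $h_{k+1}^j=h\gamma_{k+1}^j$ and $\theta_{k+1}^j=t_k^j+h\gamma_{k+1}^j$.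 Set $y_k^{-1}=\varphi(t_k^{-1})$ for $k=0,1,\ldots,N$. For $j=0$: $y_0^0=y_N^{-1}$ and, for $k=0,\ldots,N-1$, $$\tilde y_{k+1}^{-1,0}=\varphi(t_k^{-1}+h_{k+1}^0),\quad \tilde y_{k+1}^0=y_k^0+h_{k+1}^0 f(t_k^0,y_k^0,y_k^{-1}),\quad y_{k+1}^0=y_k^0+h\,f(\theta_{k+1}^0,\tilde y_{k+1}^0,\tilde y_{k+1}^{-1,0}).$$ For $j=1,\ldots,n$: $y_0^j=y_N^{j-1}$ and, for $k=0,\ldots,N-1$, $$\tilde y_{k+1}^{j-1,j}=y_k^{j-1}+h_{k+1}^j f(t_k^{j-1},y_k^{j-1},y_k^{j-2}),\quad \tilde y_{k+1}^j=y_k^j+h_{k+1}^j f(t_k^j,y_k^j,y_k^{j-1}),$$ $$y_{k+1}^j=y_k^j+h\,f(\theta_{k+1}^j,\tilde y_{k+1}^j,\tilde y_{k+1}^{j-1,j}).$$ *)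

theory Defs
  imports "HOL-Probability.Probability"
begin

text \<open>Epsilon-delta absolute continuity of a function on a real interval. A division is a finite set
  of nonempty compact intervals with pairwise disjoint interiors; \<open>Inf K\<close> and \<open>Sup K\<close> are the
  endpoints of the interval \<open>K\<close>. (The library's \<open>absolutely_continuous\<close> is about measures.)\<close>

definition absolutely_continuous_fun_on :: "real set \<Rightarrow> (real \<Rightarrow> 'a::real_normed_vector) \<Rightarrow> bool"
  where "absolutely_continuous_fun_on S g \<longleftrightarrow>
    (\<forall>\<epsilon>>0. \<exists>\<delta>>0. \<forall>\<D> T. \<D> division_of T \<longrightarrow> T \<subseteq> S \<longrightarrow> (\<Sum>K\<in>\<D>. Sup K - Inf K) < \<delta> \<longrightarrow>
      (\<Sum>K\<in>\<D>. norm (g (Sup K) - g (Inf K))) < \<epsilon>)"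

text \<open>Caratheodory solution of \<open>x'(t) = f(t, x(t), x(t - \<tau>))\<close> on \<open>[0, (n+1)\<tau>]\<close> with initial
  function \<open>\<phi>\<close> on \<open>[-\<tau>, 0]\<close>. Values of \<open>x\<close> outside \<open>[-\<tau>, (n+1)\<tau>]\<close> are irrelevant.\<close>

definition dde_solution ::
  "(real \<Rightarrow> 'a \<Rightarrow> 'a \<Rightarrow> 'a::real_normed_vector) \<Rightarrow> (real \<Rightarrow> 'a) \<Rightarrow> real \<Rightarrow> nat \<Rightarrow> (real \<Rightarrow> 'a) \<Rightarrow> bool"
  where "dde_solution f \<phi> \<tau> n x \<longleftrightarrow>
    (\<forall>t\<in>{-\<tau>..0}. x t = \<phi> t) \<and>
    absolutely_continuous_fun_on {0..(real n + 1) * \<tau>} x \<and>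
    (AE t in lebesgue_on {0..(real n + 1) * \<tau>}.
      (x has_vector_derivative f t (x t) (x (t - \<tau>))) (at t within {0..(real n + 1) * \<tau>}))"

text \<open>Grid point \<open>t\<^sub>k\<^sup>j = j\<tau> + k h\<close> with \<open>h = \<tau> / N\<close>; the superscript \<open>j\<close> may be \<open>-1\<close>.\<close>

definition tgrid :: "real \<Rightarrow> nat \<Rightarrow> int \<Rightarrow> nat \<Rightarrow> real"
  where "tgrid \<tau> N j k = of_int j * \<tau> + real k * (\<tau> / real N)"

text \<open>The randomized two-stage Runge-Kutta scheme for one realisation \<open>g\<close> of the random variables,
  \<open>g j k\<close> being the value of \<open>\<gamma>\<^sub>k\<^sup>j\<close> (used only for \<open>k \<ge> 1\<close>). The superscript is shifted by one so
  that it is a natural number: \<open>rk_shifted f \<phi> \<tau> N g J k\<close> is \<open>y\<^sub>k\<close> with superscript \<open>J - 1\<close>.\<close>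

fun rk_shifted ::
  "(real \<Rightarrow> 'a \<Rightarrow> 'a \<Rightarrow> 'a::real_vector) \<Rightarrow> (real \<Rightarrow> 'a) \<Rightarrow> real \<Rightarrow> nat \<Rightarrow> (nat \<Rightarrow> nat \<Rightarrow> real) \<Rightarrow>
    nat \<Rightarrow> nat \<Rightarrow> 'a"
  where
    "rk_shifted f \<phi> \<tau> N g 0 k = \<phi> (tgrid \<tau> N (- 1) k)"
  | "rk_shifted f \<phi> \<tau> N g (Suc J) 0 = rk_shifted f \<phi> \<tau> N g J N"
  | "rk_shifted f \<phi> \<tau> N g (Suc 0) (Suc k) =
      (let h = \<tau> / real N;
           hg = h * g 0 (Suc k);
           y = rk_shifted f \<phi> \<tau> N g (Suc 0) k;
           z = rk_shifted f \<phi> \<tau> N g 0 k;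
           z_tilde = \<phi> (tgrid \<tau> N (- 1) k + hg);
           y_tilde = y + hg *\<^sub>R f (tgrid \<tau> N 0 k) y z
       in y + h *\<^sub>R f (tgrid \<tau> N 0 k + hg) y_tilde z_tilde)"
  | "rk_shifted f \<phi> \<tau> N g (Suc (Suc i)) (Suc k) =
      (let h = \<tau> / real N;
           j = Suc i;
           hg = h * g j (Suc k);
           y = rk_shifted f \<phi> \<tau> N g (Suc (Suc i)) k;
           z = rk_shifted f \<phi> \<tau> N g (Suc i) k;
           w = rk_shifted f \<phi> \<tau> N g i k;
           z_tilde = z + hg *\<^sub>R f (tgrid \<tau> N (int j - 1) k) z w;
           y_tilde = y + hg *\<^sub>R f (tgrid \<tau> N (int j) k) y z
       in y + h *\<^sub>R f (tgrid \<tau> N (int j) k + hg) y_tilde z_tilde)"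

definition rk_scheme ::
  "(real \<Rightarrow> 'a \<Rightarrow> 'a \<Rightarrow> 'a::real_vector) \<Rightarrow> (real \<Rightarrow> 'a) \<Rightarrow> real \<Rightarrow> nat \<Rightarrow> (nat \<Rightarrow> nat \<Rightarrow> real) \<Rightarrow>
    nat \<Rightarrow> nat \<Rightarrow> 'a"
  where "rk_scheme f \<phi> \<tau> N g j k = rk_shifted f \<phi> \<tau> N g (Suc j) k"

text \<open>The Bochner integral is \<open>0\<close> for non-integrable functions, so the value of \<open>Lp_norm M p X\<close> is
  meaningful only together with \<open>in_Lp M p X\<close>.\<close>

definition in_Lp :: "'w measure \<Rightarrow> real \<Rightarrow> ('w \<Rightarrow> 'a::euclidean_space) \<Rightarrow> bool"
  where "in_Lp M p X \<longleftrightarrow> X \<in> borel_measurable M \<and> integrable M (\<lambda>\<omega>. norm (X \<omega>) powr p)"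

definition Lp_norm :: "'w measure \<Rightarrow> real \<Rightarrow> ('w \<Rightarrow> 'a::euclidean_space) \<Rightarrow> real"
  where "Lp_norm M p X = (\<integral>\<omega>. norm (X \<omega>) powr p \<partial>M) powr (1 / p)"

text \<open>The value of \<open>\<gamma>s\<close> at \<open>(j, 0)\<close> is unconstrained, since the subscript \<open>k\<close> starts at \<open>1\<close>.\<close>

definition iid_uniform_family :: "'w measure \<Rightarrow> (nat \<Rightarrow> nat \<Rightarrow> 'w \<Rightarrow> real) \<Rightarrow> bool"
  where "iid_uniform_family M \<gamma>s \<longleftrightarrow>
    prob_space.indep_vars M (\<lambda>_. borel) (\<lambda>(j, k). \<gamma>s j k) (UNIV \<times> {1..}) \<and>
    (\<forall>j. \<forall>k\<ge>1. distr M lborel (\<gamma>s j k) = uniform_measure lborel {0<..<1})"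

end

theory Submission
  imports Defs
begin

text \<open>An absolutely continuous solution satisfies the integral equation, so its derivative is continuous
  and, by compactness, Hoelder of order \<open>\<mu> = min \<gamma> \<alpha>\<close>. On one interval of length \<open>\<tau>\<close> the scheme differs
  from the exact solution by accumulated randomized quadrature errors plus terms controlled, via the
  Lipschitz and Hoelder bounds on \<open>f\<close> and the discrete Gronwall lemma, by the errors on the two previous
  intervals. The quadrature errors are independent, centred and of size \<open>O(h\<^bsup>1+\<mu>\<^esup>)\<close>, so the maximum
  of their partial sums has \<open>p\<close>-th moment \<open>O(h\<^bsup>(1/2+\<mu>)p\<^esup>)\<close>; instead of the Burkholder inequality, Doob's
  inequality for \<open>exp\<close> of the partial sums and Hoeffding's lemma suffice, since the summands are bounded.
  Each interval raises the error to the power \<open>\<alpha>\<close>, which a weak form of Jensen's inequality passes to the moments.\<close>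

section \<open>Moments of the maximum of partial sums\<close>

text \<open>The numerical path depends nonlinearly on all earlier random nodes, so the local errors
  of the scheme are not independent. The randomness is therefore split off along the exact solution:
  a quadrature error samples the deterministic function \<open>xdot\<close> at a single random node,
  and everything that involves the numerical path is estimated pathwise. Cancellation is used only
  in the quadrature errors: N of them, each of size h^(1+\<mu>), accumulate to order sqrt N *
  h^(1+\<mu>), which gives the 1/2 in the rate. The obstacle to a linear recursion is that f is only
  Hoelder in its delayed argument. Grid errors of the previous interval enter with power \<alpha>.
  The delayed stage is itself predicted by f from values two intervals back, so an error there
  passes through f twice and enters with power \<open>\<alpha>\<^sup>2\<close>. If the order shrinks
  by the factor \<alpha> from one interval to the next, both contributions have the same
  order.\<close>

lemma running_max_summation:
  fixes s :: "nat \<Rightarrow> real"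
  shows "(Max (s ` {..N}))\<^sup>2 / 2 + (\<Sum>k<N. Max (s ` {..k}) * (s (Suc k) - s k)) \<le> Max (s ` {..N}) * s N"
proof (induction N)
  case 0
  then show ?case by (simp add: power2_eq_square)
next
  case (Suc N)
  let ?A = "Max (s ` {..N})"
  have M: "Max (s ` {..Suc N}) = max (s (Suc N)) ?A"
    by (simp add: atMost_Suc)
  \<comment> \<open>Without a new maximum both sides grow by the same amount. With one, the
    induction hypothesis leaves the slack \<open>(s (Suc N) - ?A)\<^sup>2 / 2\<close>.\<close>
  show ?case
  proof (cases "s (Suc N) \<le> ?A")
    case True
    then show ?thesis using Suc M by (simp add: algebra_simps max_def)
  next
    case False
    have "0 \<le> (s (Suc N) - ?A)\<^sup>2" by simp
    then show ?thesis using Suc M False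
      by (simp add: algebra_simps max_def power2_eq_square)
  qed
qed

lemma running_max_square_le:
  fixes s :: "nat \<Rightarrow> real"
  shows "(Max (s ` {..N}))\<^sup>2 \<le> 4 * (s N)\<^sup>2 - 4 * (\<Sum>k<N. Max (s ` {..k}) * (s (Suc k) - s k))"
proof -
  have "0 \<le> (Max (s ` {..N}) - 2 * s N)\<^sup>2" by simp
  then show ?thesis using running_max_summation[of s N]
    by (simp add: algebra_simps power2_eq_square)
qed

text \<open>Halving the exponent lets the L2 inequality act on \<open>exp\<close> of half the sum:
  its square is \<open>exp\<close> of the full sum, a product of independent factors. Hoeffding's
  lemma on [-c, c] bounds each factor by exp((2c)^2 / 8) = exp(c^2 / 2).\<close>

lemma (in prob_space) expectation_exp_max_partial_sums:
  fixes X :: "nat \<Rightarrow> 'a \<Rightarrow> real"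
  assumes ind: "indep_vars (\<lambda>_. borel) X {..<N}"
    and bd: "\<And>i \<omega>. i < N \<Longrightarrow> \<omega> \<in> space M \<Longrightarrow> \<bar>X i \<omega>\<bar> \<le> c"
    and mean: "\<And>i. i < N \<Longrightarrow> expectation (X i) = 0"
  shows "integrable M (\<lambda>\<omega>. (Max ((\<lambda>k. exp ((\<Sum>i<k. X i \<omega>) / 2)) ` {..N}))\<^sup>2)"
    and "expectation (\<lambda>\<omega>. (Max ((\<lambda>k. exp ((\<Sum>i<k. X i \<omega>) / 2)) ` {..N}))\<^sup>2) \<le> 4 * exp (real N * c\<^sup>2 / 2)"
proof -
  have rv: "random_variable borel (X i)" if "i < N" for i
    using ind that by (auto simp: indep_vars_def)
  have rvsum [measurable]: "random_variable borel (\<lambda>\<omega>. \<Sum>i<k. X i \<omega>)" if "k \<le> N" for k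
    using that by (intro borel_measurable_sum rv) auto
  define s where "s \<omega> k = exp ((\<Sum>i<k. X i \<omega>) / 2)" for \<omega> k
  define S where "S \<omega> k = Max (s \<omega> ` {..k})" for \<omega> k
  have s_meas [measurable]: "random_variable borel (\<lambda>\<omega>. s \<omega> k)" if "k \<le> N" for k
    unfolding s_def using rvsum[OF that] by measurable
  have S_meas [measurable]: "random_variable borel (\<lambda>\<omega>. S \<omega> k)" if "k \<le> N" for k
    unfolding S_def by (intro borel_measurable_Max s_meas) (use that in auto)
  have sum_bd: "\<bar>\<Sum>i<k. X i \<omega>\<bar> \<le> real N * \<bar>c\<bar>" if "k \<le> N" "\<omega> \<in> space M" for k \<omega>
  proof -
    have "\<bar>\<Sum>i<k. X i \<omega>\<bar> \<le> (\<Sum>i<k. \<bar>c\<bar>)"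
    proof (rule order_trans[OF sum_abs sum_mono])
      fix i assume "i \<in> {..<k}"
      then show "\<bar>X i \<omega>\<bar> \<le> \<bar>c\<bar>" using bd[of i \<omega>] that by auto
    qed
    also have "\<dots> \<le> real N * \<bar>c\<bar>" using that by (simp add: mult_right_mono)
    finally show ?thesis .
  qed
  \<comment> \<open>A crude bound, used only to make every variable below bounded and hence
    integrable.\<close>
  define K where "K = exp (real N * \<bar>c\<bar> / 2)"
  have s_pos: "0 < s \<omega> k" for \<omega> k by (simp add: s_def)
  have s_bd: "s \<omega> k \<le> K" if "k \<le> N" "\<omega> \<in> space M" for k \<omega>
    using sum_bd[OF that] by (auto simp: s_def K_def)
  have S_bd: "0 < S \<omega> k \<and> S \<omega> k \<le> K" if "k \<le> N" "\<omega> \<in> space M" for k \<omega>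
    using that s_bd s_pos by (auto simp: S_def Max_gr_iff)
  have int_b: "integrable M Y" if "random_variable borel Y" "\<And>\<omega>. \<omega> \<in> space M \<Longrightarrow> \<bar>Y \<omega>\<bar> \<le> B"
    for Y :: "'a \<Rightarrow> real" and B
    by (rule integrable_const_bound[where B = B]) (use that in auto)
  \<comment> \<open>The submartingale property without filtrations. The term factors into
    \<open>S \<omega> k * s \<omega> k\<close>, a function of the variables before k, and
    \<open>exp (X k \<omega> / 2) - 1\<close>, a function of the k-th one, whose mean is nonnegative
    because exp u >= 1 + u.\<close>
  have inc: "expectation (\<lambda>\<omega>. S \<omega> k * (s \<omega> (Suc k) - s \<omega> k)) \<ge> 0 \<and>
      integrable M (\<lambda>\<omega>. S \<omega> k * (s \<omega> (Suc k) - s \<omega> k))" if k: "k < N" for k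
  proof -
    let ?G = "\<lambda>v::nat\<Rightarrow>real. Max ((\<lambda>j. exp ((\<Sum>i<j. v i) / 2)) ` {..k}) * exp ((\<Sum>i<k. v i) / 2)"
    let ?H = "\<lambda>v::nat\<Rightarrow>real. exp (v k / 2) - 1"
    have G: "?G \<in> borel_measurable (PiM {..<k} (\<lambda>_. borel))"
    proof -
      have "(\<lambda>v. exp ((\<Sum>i<j. v i) / 2)) \<in> borel_measurable (PiM {..<k} (\<lambda>_. borel::real measure))"
        if "j \<le> k" for j
      proof -
        have "(\<lambda>v. \<Sum>i<j. v i) \<in> borel_measurable (PiM {..<k} (\<lambda>_. borel::real measure))"
          using that by (intro borel_measurable_sum) auto
        then show ?thesis by measurable
      qed
      then show ?thesis
        by (intro borel_measurable_times borel_measurable_Max) auto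
    qed
    have H: "?H \<in> borel_measurable (PiM {k} (\<lambda>_. borel))"
      by measurable
    have "indep_var borel (?G \<circ> (\<lambda>\<omega>. restrict (\<lambda>i. X i \<omega>) {..<k}))
                    borel (?H \<circ> (\<lambda>\<omega>. restrict (\<lambda>i. X i \<omega>) {k}))"
      by (rule indep_var_compose[OF indep_var_restrict[OF ind] G H]) (use k in auto)
    moreover have "?G \<circ> (\<lambda>\<omega>. restrict (\<lambda>i. X i \<omega>) {..<k}) = (\<lambda>\<omega>. S \<omega> k * s \<omega> k)"
    proof -
      have "(\<Sum>i<j. restrict (\<lambda>i. X i \<omega>) {..<k} i) = (\<Sum>i<j. X i \<omega>)" if "j \<le> k" for j \<omega>
        using that by (intro sum.cong) auto
      then show ?thesis
        by (auto simp: fun_eq_iff S_def s_def intro!: arg_cong[where f = Max] image_cong)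
    qed
    moreover have "?H \<circ> (\<lambda>\<omega>. restrict (\<lambda>i. X i \<omega>) {k}) = (\<lambda>\<omega>. exp (X k \<omega> / 2) - 1)"
      by auto
    ultimately have iv: "indep_var borel (\<lambda>\<omega>. S \<omega> k * s \<omega> k) borel (\<lambda>\<omega>. exp (X k \<omega> / 2) - 1)"
      by simp
    have m1: "random_variable borel (\<lambda>\<omega>. S \<omega> k * s \<omega> k)"
      by (intro borel_measurable_times S_meas s_meas) (use k in auto)
    have i1: "integrable M (\<lambda>\<omega>. S \<omega> k * s \<omega> k)"
    proof (rule int_b[OF m1])
      fix \<omega> assume "\<omega> \<in> space M"
      then show "\<bar>S \<omega> k * s \<omega> k\<bar> \<le> K * K"
        using S_bd[of k \<omega>] s_bd[of k \<omega>] s_pos[of \<omega> k] k by (auto simp: abs_mult intro!: mult_mono)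
    qed
    have m2: "random_variable borel (\<lambda>\<omega>. exp (X k \<omega> / 2) - 1)"
      using rv[OF k] by measurable
    have i2: "integrable M (\<lambda>\<omega>. exp (X k \<omega> / 2) - 1)"
    proof (rule int_b[OF m2])
      fix \<omega> assume "\<omega> \<in> space M"
      then have "exp (X k \<omega> / 2) \<le> exp (\<bar>c\<bar> / 2)" using bd[OF k, of \<omega>] by auto
      moreover have "exp (X k \<omega> / 2) > 0" by simp
      ultimately show "\<bar>exp (X k \<omega> / 2) - 1\<bar> \<le> exp (\<bar>c\<bar> / 2) + 1"
        by linarith
    qed
    have iX: "integrable M (X k)" by (rule int_b[OF rv[OF k]]) (use bd k in auto)
    have "0 = expectation (\<lambda>\<omega>. X k \<omega> / 2)" using mean[OF k] by simp
    also have "\<dots> \<le> expectation (\<lambda>\<omega>. exp (X k \<omega> / 2) - 1)"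
    proof (intro integral_mono i2)
      show "integrable M (\<lambda>\<omega>. X k \<omega> / 2)" using iX by simp
      show "X k \<omega> / 2 \<le> exp (X k \<omega> / 2) - 1" for \<omega>
        using exp_ge_add_one_self[of "X k \<omega> / 2"] by linarith
    qed
    finally have e2: "0 \<le> expectation (\<lambda>\<omega>. exp (X k \<omega> / 2) - 1)" .
    have e1: "0 \<le> expectation (\<lambda>\<omega>. S \<omega> k * s \<omega> k)"
      by (intro Bochner_Integration.integral_nonneg)
         (use k S_bd s_pos in \<open>auto intro!: mult_nonneg_nonneg simp: less_imp_le S_def Max_ge_iff\<close>)
    have eq: "S \<omega> k * (s \<omega> (Suc k) - s \<omega> k) = (S \<omega> k * s \<omega> k) * (exp (X k \<omega> / 2) - 1)" for \<omega>
      by (simp add: s_def algebra_simps exp_add add_divide_distrib)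
    show ?thesis unfolding eq
      using indep_var_integrable[OF iv i1 i2] indep_var_lebesgue_integral[OF iv i1 i2] e1 e2 by simp
  qed
  have iS: "integrable M (\<lambda>\<omega>. (S \<omega> N)\<^sup>2)"
  proof (rule int_b)
    show "random_variable borel (\<lambda>\<omega>. (S \<omega> N)\<^sup>2)" by (intro borel_measurable_power S_meas) auto
    fix \<omega> assume "\<omega> \<in> space M"
    then show "\<bar>(S \<omega> N)\<^sup>2\<bar> \<le> K\<^sup>2" using S_bd[of N \<omega>] by (auto intro!: power_mono)
  qed
  have is2: "integrable M (\<lambda>\<omega>. (s \<omega> N)\<^sup>2)"
  proof (rule int_b)
    show "random_variable borel (\<lambda>\<omega>. (s \<omega> N)\<^sup>2)" by (intro borel_measurable_power s_meas) auto
    fix \<omega> assume "\<omega> \<in> space M"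
    then show "\<bar>(s \<omega> N)\<^sup>2\<bar> \<le> K\<^sup>2"
      using s_bd[of N \<omega>] s_pos[of \<omega> N] by (auto intro!: power_mono)
  qed
  have "expectation (\<lambda>\<omega>. (S \<omega> N)\<^sup>2)
      \<le> expectation (\<lambda>\<omega>. 4 * (s \<omega> N)\<^sup>2 - 4 * (\<Sum>k<N. S \<omega> k * (s \<omega> (Suc k) - s \<omega> k)))"
    using running_max_square_le inc
    by (intro integral_mono iS Bochner_Integration.integrable_diff integrable_mult_right
        Bochner_Integration.integrable_sum is2) (auto simp: S_def)
  also have "\<dots> = 4 * expectation (\<lambda>\<omega>. (s \<omega> N)\<^sup>2)
      - 4 * (\<Sum>k<N. expectation (\<lambda>\<omega>. S \<omega> k * (s \<omega> (Suc k) - s \<omega> k)))"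
    using is2 inc by (subst Bochner_Integration.integral_diff)
      (auto intro!: Bochner_Integration.integrable_sum)
  also have "\<dots> \<le> 4 * expectation (\<lambda>\<omega>. (s \<omega> N)\<^sup>2)"
    using inc by (auto intro!: sum_nonneg)
  also have "expectation (\<lambda>\<omega>. (s \<omega> N)\<^sup>2) = expectation (\<lambda>\<omega>. \<Prod>i<N. exp (X i \<omega>))"
    by (simp add: s_def exp_sum flip: exp_double)
  also have "\<dots> = (\<Prod>i<N. expectation (\<lambda>\<omega>. exp (X i \<omega>)))"
  proof (rule indep_vars_lebesgue_integral)
    show "indep_vars (\<lambda>_. borel) (\<lambda>i \<omega>. exp (X i \<omega>)) {..<N}"
      by (rule indep_vars_compose2[OF ind]) auto
    fix i assume "i \<in> {..<N}"
    then show "integrable M (\<lambda>\<omega>. exp (X i \<omega>))"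
      using rv[of i] bd[of i] by (intro int_b[of _ "exp c"]) (auto simp: abs_le_iff)
  qed auto
  also have "\<dots> \<le> (\<Prod>i<N. exp (c\<^sup>2 / 2))"
  proof (intro prod_mono conjI)
    fix i assume i: "i \<in> {..<N}"
    interpret interval_bounded_random_variable M "X i" "-c" c
    proof
      show "random_variable borel (X i)" using rv i by auto
      show "AE x in M. X i x \<in> {- c..c}"
      proof (rule AE_I2)
        fix \<omega> assume "\<omega> \<in> space M"
        then show "X i \<omega> \<in> {- c..c}" using bd[of i \<omega>] i by auto
      qed
    qed
    have ie: "integrable M (\<lambda>\<omega>. exp (X i \<omega>))"
      using rv[of i] bd[of i] i by (intro int_b[of _ "exp c"]) (auto simp: abs_le_iff)
    have "nn_integral M (\<lambda>x. exp (1 * X i x)) \<le> ennreal (exp (1\<^sup>2 * (c - (-c))\<^sup>2 / 8))"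
      using mean i by (intro Hoeffdings_lemma_nn_integral_0) auto
    then have "ennreal (expectation (\<lambda>\<omega>. exp (X i \<omega>))) \<le> ennreal (exp (c\<^sup>2 / 2))"
      using ie by (simp add: nn_integral_eq_integral power2_eq_square)
    then show "expectation (\<lambda>\<omega>. exp (X i \<omega>)) \<le> exp (c\<^sup>2 / 2)"
      by (simp add: ennreal_le_iff)
  qed simp
  also have "(\<Prod>i<N. exp (c\<^sup>2 / 2)) = exp (real N * c\<^sup>2 / 2)"
    by (simp flip: exp_of_nat_mult)
  finally show "expectation (\<lambda>\<omega>. (Max ((\<lambda>k. exp ((\<Sum>i<k. X i \<omega>) / 2)) ` {..N}))\<^sup>2) \<le> 4 * exp (real N * c\<^sup>2 / 2)"
    by (simp add: S_def s_def)
  show "integrable M (\<lambda>\<omega>. (Max ((\<lambda>k. exp ((\<Sum>i<k. X i \<omega>) / 2)) ` {..N}))\<^sup>2)"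
    using iS by (simp add: S_def s_def)
qed

lemma powr_sum_le:
  fixes a :: "'i \<Rightarrow> real"
  assumes "finite A" "\<And>i. i \<in> A \<Longrightarrow> 0 \<le> a i" "0 < p"
  shows "(\<Sum>i\<in>A. a i) powr p \<le> real (card A) powr p * (\<Sum>i\<in>A. a i powr p)"
proof (cases "A = {}")
  case False
  let ?m = "Max (a ` A)"
  have "?m \<in> a ` A" using False assms by (intro Max_in) auto
  then obtain j where j: "j \<in> A" "?m = a j" by auto
  have "(\<Sum>i\<in>A. a i) \<le> (\<Sum>i\<in>A. a j)"
    using j assms by (intro sum_mono) (metis Max_ge finite_imageI imageI)
  then have "(\<Sum>i\<in>A. a i) powr p \<le> (real (card A) * a j) powr p"
    using assms by (intro powr_mono2) (auto intro: sum_nonneg)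
  also have "\<dots> = real (card A) powr p * a j powr p"
    using assms j by (simp add: powr_mult)
  also have "\<dots> \<le> real (card A) powr p * (\<Sum>i\<in>A. a i powr p)"
    using assms j by (intro mult_left_mono member_le_sum) auto
  finally show ?thesis .
qed simp

lemma powr_le_exp:
  fixes u p :: real
  assumes "0 \<le> u" "0 < p"
  shows "u powr p \<le> p powr p * exp u"
proof -
  have "u / p \<le> exp (u / p)" using exp_ge_add_one_self[of "u / p"] by linarith
  then have "(u / p) powr p \<le> exp (u / p) powr p" using assms by (intro powr_mono2) auto
  also have "\<dots> = exp u" using assms by (simp add: powr_def)
  finally show ?thesis using assms by (simp add: powr_divide divide_simps mult.commute)
qed

text \<open>Dividing by b = c * sqrt N leaves summands of size at most 1 / sqrt N, so the
  exponential moment is at most 4 * exp(1/2), whatever N is. The absolute value is covered by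
  running the estimate for both signs, which doubles the 4 to 8; \<open>powr_le_exp\<close>
  contributes \<open>p powr p\<close>.\<close>

lemma (in prob_space) moment_max_abs_partial_sums:
  fixes X :: "nat \<Rightarrow> 'a \<Rightarrow> real"
  assumes ind: "indep_vars (\<lambda>_. borel) X {..<N}" and N: "0 < N" and c: "0 < c" and p: "0 < p"
    and bd: "\<And>i \<omega>. i < N \<Longrightarrow> \<omega> \<in> space M \<Longrightarrow> \<bar>X i \<omega>\<bar> \<le> c"
    and mean: "\<And>i. i < N \<Longrightarrow> expectation (X i) = 0"
  shows "integrable M (\<lambda>\<omega>. (Max ((\<lambda>k. \<bar>\<Sum>i<k. X i \<omega>\<bar>) ` {..N})) powr p)" (is ?int)
    and "expectation (\<lambda>\<omega>. (Max ((\<lambda>k. \<bar>\<Sum>i<k. X i \<omega>\<bar>) ` {..N})) powr p)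
      \<le> 8 * exp (1 / 2) * p powr p * (c * sqrt N) powr p" (is ?bound)
proof -
  define b where "b = c * sqrt N"
  have b: "0 < b" using N c by (simp add: b_def)
  have rv: "random_variable borel (X i)" if "i < N" for i
    using ind that by (auto simp: indep_vars_def)
  have rvsum: "random_variable borel (\<lambda>\<omega>. \<Sum>i<k. X i \<omega>)" if "k \<le> N" for k
    using that by (intro borel_measurable_sum rv) auto
  have m: "random_variable borel (\<lambda>\<omega>. (Max ((\<lambda>k. \<bar>\<Sum>i<k. X i \<omega>\<bar>) ` {..N})) powr p)"
    by (intro powr_real_measurable borel_measurable_Max borel_measurable_abs rvsum) auto
  define S where "S e \<omega> = (Max ((\<lambda>k. exp ((\<Sum>i<k. e * X i \<omega> / b) / 2)) ` {..N}))\<^sup>2" for e \<omega>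
  have S: "integrable M (S e) \<and> expectation (S e) \<le> 4 * exp (1 / 2)" if e: "\<bar>e\<bar> = 1" for e
  proof -
    have i: "indep_vars (\<lambda>_. borel) (\<lambda>i \<omega>. e * X i \<omega> / b) {..<N}"
      by (rule indep_vars_compose2[OF ind]) auto
    have bd': "\<bar>e * X i \<omega> / b\<bar> \<le> 1 / sqrt N" if "i < N" "\<omega> \<in> space M" for i \<omega>
      using bd[OF that] b e N c by (simp add: abs_mult b_def field_simps)
    have mean': "expectation (\<lambda>\<omega>. e * X i \<omega> / b) = 0" if "i < N" for i
      using mean[OF that] by simp
    show ?thesis
      using expectation_exp_max_partial_sums[OF i bd' mean'] N
      by (simp add: S_def[abs_def] power_divide)
  qed
  have le: "(Max ((\<lambda>k. \<bar>\<Sum>i<k. X i \<omega>\<bar>) ` {..N})) powr p \<le> (b * p) powr p * (S 1 \<omega> + S (-1) \<omega>)" for \<omega>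
  proof -
    let ?f = "\<lambda>k. \<bar>\<Sum>i<k. X i \<omega>\<bar>"
    have "Max (?f ` {..N}) \<in> ?f ` {..N}" by (intro Max_in) auto
    then obtain k where k: "k \<le> N" "Max (?f ` {..N}) = ?f k" by (metis (no_types, lifting) atMost_iff imageE)
    define e :: real where "e = (if (\<Sum>i<k. X i \<omega>) \<ge> 0 then 1 else -1)"
    have f: "?f k / b = (\<Sum>i<k. e * X i \<omega> / b)"
      by (simp add: e_def sum_divide_distrib[symmetric] sum_negf)
    have "exp (?f k / b) = (exp ((\<Sum>i<k. e * X i \<omega> / b) / 2))\<^sup>2"
      by (simp add: f flip: exp_double)
    also have "\<dots> \<le> S e \<omega>"
      unfolding S_def using k by (intro power_mono Max_ge) auto
    also have "\<dots> \<le> S 1 \<omega> + S (-1) \<omega>" by (auto simp: e_def S_def)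
    finally have *: "exp (?f k / b) \<le> S 1 \<omega> + S (-1) \<omega>" .
    have "?f k powr p = b powr p * (?f k / b) powr p"
      using b by (simp add: powr_divide)
    also have "\<dots> \<le> b powr p * (p powr p * exp (?f k / b))"
      using b p by (intro mult_left_mono powr_le_exp) auto
    also have "\<dots> \<le> b powr p * (p powr p * (S 1 \<omega> + S (-1) \<omega>))"
      using * by (intro mult_left_mono) auto
    finally show ?thesis using k b p by (simp add: powr_mult mult_ac)
  qed
  have iS: "integrable M (\<lambda>\<omega>. (b * p) powr p * (S 1 \<omega> + S (-1) \<omega>))"
    using S[of 1] S[of "-1"] by auto
  show i: ?int
    by (rule Bochner_Integration.integrable_bound[OF iS m])
       (use le in \<open>auto intro!: AE_I2 intro: order_trans[OF _ abs_ge_self]\<close>)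
  have "expectation (\<lambda>\<omega>. (Max ((\<lambda>k. \<bar>\<Sum>i<k. X i \<omega>\<bar>) ` {..N})) powr p)
      \<le> expectation (\<lambda>\<omega>. (b * p) powr p * (S 1 \<omega> + S (-1) \<omega>))"
    by (intro integral_mono i iS le)
  also have "\<dots> = (b * p) powr p * (expectation (S 1) + expectation (S (-1)))"
    using S[of 1] S[of "-1"] by simp
  also have "\<dots> \<le> (b * p) powr p * (8 * exp (1 / 2))"
    using S[of 1] S[of "-1"] by (intro mult_left_mono) auto
  finally show ?bound using b p by (simp add: b_def powr_mult mult_ac)
qed

text \<open>Reduction to coordinates. One factor \<open>DIM('b) powr p\<close> comes from the power
  of a sum over the basis, the other factor \<open>DIM('b)\<close> from adding up the identical
  coordinate bounds.\<close>

lemma (in prob_space) moment_max_norm_partial_sums: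
  fixes X :: "nat \<Rightarrow> 'a \<Rightarrow> 'b::euclidean_space"
  assumes ind: "indep_vars (\<lambda>_. borel) X {..<N}" and N: "0 < N" and c: "0 < c" and p: "0 < p"
    and bd: "\<And>i \<omega>. i < N \<Longrightarrow> \<omega> \<in> space M \<Longrightarrow> norm (X i \<omega>) \<le> c"
    and mean: "\<And>i. i < N \<Longrightarrow> expectation (X i) = 0"
  shows "integrable M (\<lambda>\<omega>. (Max ((\<lambda>k. norm (\<Sum>i<k. X i \<omega>)) ` {..N})) powr p)" (is ?int)
    and "expectation (\<lambda>\<omega>. (Max ((\<lambda>k. norm (\<Sum>i<k. X i \<omega>)) ` {..N})) powr p)
      \<le> DIM('b) powr p * DIM('b) * 8 * exp (1 / 2) * p powr p * (c * sqrt N) powr p" (is ?bound)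
proof -
  have rv: "random_variable borel (X i)" if "i < N" for i
    using ind that by (auto simp: indep_vars_def)
  have rvsum: "random_variable borel (\<lambda>\<omega>. \<Sum>i<k. X i \<omega>)" if "k \<le> N" for k
    using that by (intro borel_measurable_sum rv) auto
  have m: "random_variable borel (\<lambda>\<omega>. (Max ((\<lambda>k. norm (\<Sum>i<k. X i \<omega>)) ` {..N})) powr p)"
    by (intro powr_real_measurable borel_measurable_Max measurable_compose[OF rvsum borel_measurable_norm]) auto
  define T where "T b \<omega> = Max ((\<lambda>k. \<bar>\<Sum>i<k. X i \<omega> \<bullet> b\<bar>) ` {..N}) powr p" for b \<omega>
  have T: "integrable M (T b)" "expectation (T b) \<le> 8 * exp (1 / 2) * p powr p * (c * sqrt N) powr p"
    if b: "b \<in> Basis" for b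
  proof -
    have i: "indep_vars (\<lambda>_. borel) (\<lambda>i \<omega>. X i \<omega> \<bullet> b) {..<N}"
      by (rule indep_vars_compose2[OF ind]) auto
    have bd': "\<bar>X i \<omega> \<bullet> b\<bar> \<le> c" if "i < N" "\<omega> \<in> space M" for i \<omega>
      using bd[OF that] Basis_le_norm[OF b, of "X i \<omega>"] by linarith
    have mean': "expectation (\<lambda>\<omega>. X i \<omega> \<bullet> b) = 0" if "i < N" for i
    proof -
      have "integrable M (X i)"
        by (rule integrable_const_bound[where B = c]) (use rv bd that in auto)
      then show ?thesis using mean[OF that] by simp
    qed
    show "integrable M (T b)" "expectation (T b) \<le> 8 * exp (1 / 2) * p powr p * (c * sqrt N) powr p"
      using moment_max_abs_partial_sums[OF i N c p bd' mean'] by (auto simp: T_def[abs_def])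
  qed
  have le: "(Max ((\<lambda>k. norm (\<Sum>i<k. X i \<omega>)) ` {..N})) powr p
      \<le> DIM('b) powr p * (\<Sum>b\<in>Basis. T b \<omega>)" for \<omega>
  proof -
    let ?f = "\<lambda>k. norm (\<Sum>i<k. X i \<omega>)" and ?g = "\<lambda>b k. \<bar>\<Sum>i<k. X i \<omega> \<bullet> b\<bar>"
    have "Max (?f ` {..N}) \<in> ?f ` {..N}" by (intro Max_in) auto
    then obtain k where k: "k \<le> N" "Max (?f ` {..N}) = ?f k" by (metis (no_types, lifting) atMost_iff imageE)
    have "?f k \<le> (\<Sum>b\<in>Basis. ?g b k)"
      using norm_le_l1[of "\<Sum>i<k. X i \<omega>"] by (simp add: inner_sum_left)
    then have "?f k powr p \<le> (\<Sum>b\<in>Basis. ?g b k) powr p"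
      using p by (intro powr_mono2) auto
    also have "\<dots> \<le> DIM('b) powr p * (\<Sum>b\<in>Basis. ?g b k powr p)"
      using p by (intro powr_sum_le) auto
    also have "\<dots> \<le> DIM('b) powr p * (\<Sum>b\<in>Basis. T b \<omega>)"
      unfolding T_def using k p by (intro mult_left_mono sum_mono powr_mono2 Max_ge) auto
    finally show ?thesis using k by simp
  qed
  have iT: "integrable M (\<lambda>\<omega>. DIM('b) powr p * (\<Sum>b\<in>Basis. T b \<omega>))"
    using T by (intro integrable_mult_right Bochner_Integration.integrable_sum) auto
  show i: ?int
    by (rule Bochner_Integration.integrable_bound[OF iT m])
       (use le in \<open>auto intro!: AE_I2 intro: order_trans[OF _ abs_ge_self]\<close>)
  have "expectation (\<lambda>\<omega>. (Max ((\<lambda>k. norm (\<Sum>i<k. X i \<omega>)) ` {..N})) powr p)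
      \<le> expectation (\<lambda>\<omega>. DIM('b) powr p * (\<Sum>b\<in>Basis. T b \<omega>))"
    by (intro integral_mono i iT le)
  also have "\<dots> = DIM('b) powr p * (\<Sum>b\<in>Basis. expectation (T b))"
    using T by simp
  also have "\<dots> \<le> DIM('b) powr p * (\<Sum>b\<in>(Basis::'b set). 8 * exp (1 / 2) * p powr p * (c * sqrt N) powr p)"
    using T by (intro mult_left_mono sum_mono) auto
  finally show ?bound by (simp add: mult_ac)
qed

section \<open>Absolutely continuous functions and the delay equation\<close>

lemma absolutely_continuous_fun_on_subset:
  "absolutely_continuous_fun_on S g \<Longrightarrow> T \<subseteq> S \<Longrightarrow> absolutely_continuous_fun_on T g"
  unfolding absolutely_continuous_fun_on_def by (meson order_trans)

lemma absolutely_continuous_imp_continuous_on: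
  fixes g :: "real \<Rightarrow> 'a::real_normed_vector"
  assumes "absolutely_continuous_fun_on {a..b} g"
  shows "continuous_on {a..b} g"
  unfolding continuous_on_iff
proof safe
  fix s e :: real assume s: "s \<in> {a..b}" and e: "0 < e"
  from assms e obtain \<delta> where \<delta>: "\<delta> > 0" and *: "\<And>\<D> T. \<lbrakk>\<D> division_of T; T \<subseteq> {a..b};
      (\<Sum>K\<in>\<D>. Sup K - Inf K) < \<delta>\<rbrakk> \<Longrightarrow> (\<Sum>K\<in>\<D>. norm (g (Sup K) - g (Inf K))) < e"
    unfolding absolutely_continuous_fun_on_def by meson
  have "dist (g t) (g s) < e" if t: "t \<in> {a..b}" "dist t s < \<delta>" for t
  proof -
    let ?u = "min s t" and ?v = "max s t"
    have "{cbox ?u ?v} division_of cbox ?u ?v" by (rule division_of_self) simp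
    from *[OF this] s t have "norm (g ?v - g ?u) < e"
      by (auto simp: dist_real_def)
    then show ?thesis by (auto simp: dist_norm max_def min_def norm_minus_commute split: if_splits)
  qed
  then show "\<exists>d>0. \<forall>x'\<in>{a..b}. dist x' s < d \<longrightarrow> dist (g x') (g s) < e" using \<delta> by auto
qed

text \<open>A gauge separates two kinds of tags. Intervals tagged in the null set are forced into an
  open set of measure below \<delta>, so absolute continuity bounds the increments of
  \<open>F\<close> over them; every other tag is a point of differentiability and obeys a straddle
  estimate.\<close>

lemma has_integral_absolutely_continuous:
  fixes F :: "real \<Rightarrow> 'a::banach"
  assumes ac: "absolutely_continuous_fun_on {a..b} F" and N: "negligible N" and ab: "a \<le> b"
    and deriv: "\<And>t. t \<in> {a..b} - N \<Longrightarrow> (F has_vector_derivative g t) (at t within {a..b})"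
  shows "(g has_integral F b - F a) {a..b}"
proof -
  \<comment> \<open>With value 0 on \<open>N\<close>, the Riemann sum has no term at the bad tags
    and only the increments of \<open>F\<close> remain there.\<close>
  define g' where "g' t = (if t \<in> N then 0 else g t)" for t
  have "(g' has_integral F b - F a) {a..b}"
    unfolding has_integral_real
  proof safe
    fix e :: real assume e: "0 < e"
    then obtain \<delta> where \<delta>: "\<delta> > 0" and AC: "\<And>\<D> T. \<lbrakk>\<D> division_of T; T \<subseteq> {a..b};
        (\<Sum>K\<in>\<D>. Sup K - Inf K) < \<delta>\<rbrakk> \<Longrightarrow> (\<Sum>K\<in>\<D>. norm (F (Sup K) - F (Inf K))) < e / 2"
      using ac unfolding absolutely_continuous_fun_on_def by (meson half_gt_zero)
    have N0: "N \<in> null_sets lebesgue"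
      using N by (simp add: negligible_iff_null_sets)
    obtain U where U: "open U" "N \<subseteq> U" and "emeasure lebesgue (U - N) < ennreal \<delta>"
      using sets_lebesgue_outer_open[OF null_setsD2[OF N0] \<delta>] .
    then have eU: "emeasure lebesgue U < ennreal \<delta>"
      using N0 by (simp add: emeasure_Diff_null_set)
    have Um: "U \<in> lmeasurable"
      using eU \<open>open U\<close> by (intro fmeasurableI) (auto intro: order.strict_trans)
    then have "measure lebesgue U < \<delta>"
      using eU \<delta> by (simp add: emeasure_eq_measure2 ennreal_less_iff)
    note U = U Um this
    \<comment> \<open>The \<open>+ 1\<close> keeps the denominator positive when a = b.\<close>
    define e' where "e' = e / (2 * (b - a) + 1)"
    have e': "0 < e'" "e' * (b - a) \<le> e / 2"
      using e ab by (auto simp: e'_def field_simps)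
    have "\<forall>x. \<exists>d>0. x \<in> {a..b} - N \<longrightarrow>
         (\<forall>y\<in>{a..b}. norm (y-x) < d \<longrightarrow> norm (F y - F x - (y-x) *\<^sub>R g x) \<le> e' * norm (y-x))"
      using deriv[unfolded has_vector_derivative_def has_derivative_within_alt] e'(1)
      by (metis zero_less_one)
    then obtain d where d: "\<And>x. 0 < d x"
        "\<And>x y. \<lbrakk>x \<in> {a..b} - N; y \<in> {a..b}; norm (y-x) < d x\<rbrakk>
                        \<Longrightarrow> norm (F y - F x - (y-x) *\<^sub>R g x) \<le> e' * norm (y-x)"
      by metis
    define G where "G t = (if t \<in> N then U else ball t (d t))" for t
    have "gauge G" using U d by (auto simp: gauge_def G_def)
    moreover have "norm ((\<Sum>(x,K)\<in>p. measure lborel K *\<^sub>R g' x) - (F b - F a)) < e"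
      if p: "p tagged_division_of {a..b}" and fine: "G fine p" for p
    proof -
      have fin: "finite p" using p by blast
      have Kuv: "\<exists>u v. u \<le> v \<and> K = {u..v} \<and> x \<in> K \<and> K \<subseteq> {a..b} \<and> x \<in> {a..b}" if "(x, K) \<in> p" for x K
        using tagged_division_ofD(2-4)[OF p that] by (metis atLeastAtMost_iff box_real(2) order_trans subsetD)
      define q where "q = {k \<in> p. fst k \<in> N}"
      have qp: "q \<subseteq> p" by (auto simp: q_def)
      have qpart: "q tagged_partial_division_of {a..b}"
        using tagged_partial_division_subset[OF _ qp] p by (auto simp: tagged_division_of_def)
      have qdiv: "snd ` q division_of \<Union>(snd ` q)"
        by (rule partial_division_of_tagged_division[OF qpart])
      have qU: "\<Union>(snd ` q) \<subseteq> U"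
        using fine by (force simp: q_def fine_def G_def)
      have KS: "\<exists>u v. u \<le> v \<and> K = {u..v} \<and> K \<subseteq> {a..b}" if K: "K \<in> snd ` q" for K
      proof -
        obtain y where "(y, K) \<in> p" using K qp by (metis imageE prod.collapse subsetD)
        then show ?thesis using Kuv by meson
      qed
      have qab: "\<Union>(snd ` q) \<subseteq> {a..b}"
        using KS by (meson Union_least)
      have SI: "Sup K - Inf K = measure lebesgue K" if "K \<in> snd ` q" for K
        using KS[OF that] by auto
      have "(\<Sum>K\<in>snd ` q. Sup K - Inf K) = measure lebesgue (\<Union>(snd ` q))"
        using SI content_division[OF qdiv] by simp
      also have "\<dots> \<le> measure lebesgue U"
        using qU U lmeasurable_division[OF qdiv] by (intro measure_mono_fmeasurable) auto
      finally have "(\<Sum>K\<in>snd ` q. Sup K - Inf K) < \<delta>" using U by simp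
      from AC[OF qdiv qab this] have A: "(\<Sum>K\<in>snd ` q. norm (F (Sup K) - F (Inf K))) < e / 2" .
      \<comment> \<open>Summing over intervals instead of tagged pairs merges pairs that share an
        interval, which happens only for degenerate intervals. The summand must vanish on those; the
        empty set is treated separately since \<open>Sup\<close> and \<open>Inf\<close> say nothing
        there.\<close>
      let ?D = "\<lambda>K::real set. if K = {} then 0 else norm (F (Sup K) - F (Inf K))"
      have "(\<Sum>(x,K)\<in>q. ?D K) = (\<Sum>K\<in>snd ` q. ?D K)"
        by (rule sum.over_tagged_division_lemma[OF tagged_partial_division_of_Union_self[OF qpart]])
           (auto simp: box_eq_empty)
      also have "\<dots> = (\<Sum>K\<in>snd ` q. norm (F (Sup K) - F (Inf K)))"
        using KS by (intro sum.cong) fastforce+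
      finally have B: "(\<Sum>(x,K)\<in>q. ?D K) < e / 2" using A by simp
      have term_q: "norm (measure lborel K *\<^sub>R g' x - (F (Sup K) - F (Inf K))) \<le> ?D K" if "(x, K) \<in> q" for x K
      proof -
        have xK: "(x, K) \<in> p" "x \<in> N" using that by (auto simp: q_def)
        then have "K \<noteq> {}" using Kuv by (metis empty_iff)
        then show ?thesis using xK by (simp add: g'_def norm_minus_commute)
      qed
      have term_r: "norm (measure lborel K *\<^sub>R g' x - (F (Sup K) - F (Inf K))) \<le> e' * measure lborel K" if "(x, K) \<in> p - q" for x K
      proof -
        have xK: "(x, K) \<in> p" "x \<notin> N" using that by (auto simp: q_def)
        obtain u v where K: "u \<le> v" "K = {u..v}" "x \<in> K" "K \<subseteq> {a..b}" "x \<in> {a..b}"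
          using Kuv[OF xK(1)] by blast
        have x: "x \<in> {a..b} - N" using xK K by simp
        have "K \<subseteq> ball x (d x)" using fine xK by (force simp: fine_def G_def)
        moreover have "u \<in> K" "v \<in> K" using K by simp_all
        ultimately have "u \<in> ball x (d x)" "v \<in> ball x (d x)" by blast+
        then have du: "norm (u - x) < d x" "norm (v - x) < d x"
          by (simp_all add: dist_norm norm_minus_commute)
        \<comment> \<open>The tag lies between u and v, so the errors at the two ends, e' * (x - u)
          and e' * (v - x), add up to exactly e' * (v - u).\<close>
        have "norm ((v - u) *\<^sub>R g x - (F v - F u)) = norm ((F u - F x - (u - x) *\<^sub>R g x) - (F v - F x - (v - x) *\<^sub>R g x))"
          by (auto simp: algebra_simps)
        also have "\<dots> \<le> e' * norm (u - x) + e' * norm (v - x)"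
          using K x du by (intro order_trans[OF norm_triangle_ineq4] add_mono d) auto
        also have "\<dots> = e' * (v - u)" using K by (simp add: algebra_simps)
        finally show ?thesis using K x by (simp add: g'_def)
      qed
      have "(\<Sum>(x,K)\<in>p. measure lborel K *\<^sub>R g' x) - (F b - F a)
          = (\<Sum>(x,K)\<in>p. measure lborel K *\<^sub>R g' x - (F (Sup K) - F (Inf K)))"
        unfolding additive_tagged_division_1[OF ab p, symmetric]
        by (simp add: sum_subtractf case_prod_unfold)
      also have "norm \<dots> \<le> (\<Sum>(x,K)\<in>p. norm (measure lborel K *\<^sub>R g' x - (F (Sup K) - F (Inf K))))"
        by (rule order_trans[OF norm_sum]) (simp add: case_prod_unfold)
      also have "\<dots> = (\<Sum>(x,K)\<in>p-q. norm (measure lborel K *\<^sub>R g' x - (F (Sup K) - F (Inf K))))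
          + (\<Sum>(x,K)\<in>q. norm (measure lborel K *\<^sub>R g' x - (F (Sup K) - F (Inf K))))"
        using fin qp by (rule sum.subset_diff[OF _ _, rotated])
      also have "\<dots> \<le> (\<Sum>(x,K)\<in>p-q. e' * measure lborel K) + (\<Sum>(x,K)\<in>q. ?D K)"
        using term_q term_r by (intro add_mono sum_mono) (auto simp: case_prod_unfold)
      also have "(\<Sum>(x,K)\<in>p-q. e' * measure lborel K) \<le> (\<Sum>(x,K)\<in>p. e' * measure lborel K)"
        using fin e' by (intro sum_mono2) auto
      also have "\<dots> = e' * (b - a)"
        using additive_content_tagged_division[of p a b] p ab
        by (simp add: sum_distrib_left[symmetric] case_prod_unfold)
      finally show ?thesis using B e' by linarith
    qed
    ultimately show "\<exists>G. gauge G \<and> (\<forall>\<D>. \<D> tagged_division_of {a..b} \<and> G fine \<D> \<longrightarrow>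
        norm ((\<Sum>(x,K)\<in>\<D>. measure lborel K *\<^sub>R g' x) - (F b - F a)) < e)"
      by (intro exI[of _ G] conjI allI impI) (assumption | elim conjE)+
  qed
  moreover have "g t = g' t" if "t \<in> {a..b} - N" for t using that by (simp add: g'_def)
  ultimately show ?thesis by (rule has_integral_spike[OF N, rotated])
qed

section \<open>Regularity of the exact solution\<close>

locale dde_holder =
  fixes n :: nat and \<tau> \<alpha> \<gamma> L :: real
    and f :: "real \<Rightarrow> 'a \<Rightarrow> 'a \<Rightarrow> 'a::euclidean_space" and \<phi> x :: "real \<Rightarrow> 'a"
  assumes tau: "0 < \<tau>" and al: "0 < \<alpha>" "\<alpha> \<le> 1" and ga: "0 < \<gamma>" "\<gamma> \<le> 1" and L: "0 \<le> L"
    and f_lip: "\<And>t x1 x2 z1 z2. t \<in> {0..(real n + 1) * \<tau>} \<Longrightarrow>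
        norm (f t x1 z1 - f t x2 z2) \<le> L * (norm (x1 - x2) + norm (z1 - z2) powr \<alpha>)"
    and f_time: "\<And>t1 t2 u z. t1 \<in> {0..(real n + 1) * \<tau>} \<Longrightarrow> t2 \<in> {0..(real n + 1) * \<tau>} \<Longrightarrow>
        norm (f t1 u z - f t2 u z) \<le> L * (1 + norm u + norm z) * \<bar>t1 - t2\<bar> powr \<gamma>"
    and phi_lip: "\<And>s t. s \<in> {-\<tau>..0} \<Longrightarrow> t \<in> {-\<tau>..0} \<Longrightarrow> norm (\<phi> t - \<phi> s) \<le> L * \<bar>t - s\<bar>"
    and sol: "dde_solution f \<phi> \<tau> n x"
begin

abbreviation T_end ("T") where "T_end \<equiv> (real n + 1) * \<tau>"

definition \<mu> where "\<mu> = min \<gamma> \<alpha>"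

definition xdot where "xdot t = f t (x t) (x (t - \<tau>))"

lemma T_pos: "0 < T" using tau by simp

lemma mu: "0 < \<mu>" "\<mu> \<le> 1" "\<mu> \<le> \<alpha>" "\<mu> \<le> \<gamma>"
  using al ga by (auto simp: \<mu>_def)

lemma x_eq_phi: "t \<in> {-\<tau>..0} \<Longrightarrow> x t = \<phi> t"
  using sol by (simp add: dde_solution_def)

text \<open>The Hoelder bounds in the state are uniform in time, so together with the bound in time
  they give joint continuity. Continuity of \<open>xdot\<close> and measurability of the random
  stages both rest on it.\<close>

lemma f_continuous: "continuous_on ({0..T} \<times> UNIV) (\<lambda>(t, u, z). f t u z)"
  unfolding continuous_on_def
proof safe
  fix t0 u0 z0 assume t0: "t0 \<in> {0..T}"
  let ?F = "at (t0, u0, z0) within {0..T} \<times> (UNIV :: ('a \<times> 'a) set)"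
  let ?b = "\<lambda>(t, u, z). L * (norm (u - u0) + norm (z - z0) powr \<alpha>) + L * (1 + norm u0 + norm z0) * \<bar>t - t0\<bar> powr \<gamma>"
  have "((\<lambda>(t, u, z). f t u z - f t0 u0 z0) \<longlongrightarrow> 0) ?F"
  proof (rule Lim_null_comparison)
    show "\<forall>\<^sub>F w in ?F. norm (case w of (t, u, z) \<Rightarrow> f t u z - f t0 u0 z0) \<le> ?b w"
      unfolding eventually_at_filter
    proof (intro always_eventually allI impI)
      fix w assume "w \<in> {0..T} \<times> (UNIV :: ('a \<times> 'a) set)"
      then obtain t u z where w: "w = (t, u, z)" "t \<in> {0..T}" by auto
      have "norm (f t u z - f t0 u0 z0) \<le> norm (f t u z - f t u0 z0) + norm (f t u0 z0 - f t0 u0 z0)"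
        by (rule order_trans[OF _ norm_triangle_ineq]) simp
      then show "norm (case w of (t, u, z) \<Rightarrow> f t u z - f t0 u0 z0) \<le> ?b w"
        using f_lip[OF w(2), of u z u0 z0] f_time[OF w(2) t0, of u0 z0] w by auto
    qed
    have "((\<lambda>w. L * (norm (fst (snd w) - u0) + norm (snd (snd w) - z0) powr \<alpha>)
        + L * (1 + norm u0 + norm z0) * \<bar>fst w - t0\<bar> powr \<gamma>)
      \<longlongrightarrow> L * (norm (fst (snd (t0, u0, z0)) - u0) + 0)
        + L * (1 + norm u0 + norm z0) * 0) ?F"
    proof (intro tendsto_intros)
      show "((\<lambda>w. norm (snd (snd w) - z0) powr \<alpha>) \<longlongrightarrow> 0) ?F"
        by (rule tendsto_zero_powrI[where b = \<alpha>]) (use al in \<open>auto intro!: tendsto_eq_intros\<close>)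
      show "((\<lambda>w. \<bar>fst w - t0\<bar> powr \<gamma>) \<longlongrightarrow> 0) ?F"
        by (rule tendsto_zero_powrI[where b = \<gamma>]) (use ga in \<open>auto intro!: tendsto_eq_intros\<close>)
    qed
    then show "(?b \<longlongrightarrow> 0) ?F" by (simp add: case_prod_unfold)
  qed
  then have "((\<lambda>w. (case w of (t, u, z) \<Rightarrow> f t u z) - f t0 u0 z0) \<longlongrightarrow> 0) ?F"
    by (simp add: case_prod_unfold)
  then show "((\<lambda>(t, u, z). f t u z) \<longlongrightarrow> f t0 u0 z0) ?F"
    by (simp add: LIM_zero_iff)
qed

lemma phi_continuous: "continuous_on {-\<tau>..0} \<phi>"
proof (rule continuous_on_subset[OF lipschitz_on_continuous_on])
  show "L-lipschitz_on {-\<tau>..0} \<phi>"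
    using phi_lip L by (intro lipschitz_onI) (auto simp: dist_norm)
qed simp

lemma x_continuous: "continuous_on {-\<tau>..T} x"
proof -
  have "continuous_on {-\<tau>..0} x"
    by (rule continuous_on_eq[OF phi_continuous]) (simp add: x_eq_phi)
  moreover have "continuous_on {0..T} x"
    using sol by (intro absolutely_continuous_imp_continuous_on) (simp add: dde_solution_def)
  ultimately have "continuous_on ({-\<tau>..0} \<union> {0..T}) x"
    by (intro continuous_on_closed_Un) auto
  moreover have "{-\<tau>..0} \<union> {0..T} = {-\<tau>..T}" using tau T_pos by (intro ivl_disj_un_two_touch) simp_all
  ultimately show ?thesis by metis
qed

lemma xdot_continuous: "continuous_on {0..T} xdot"
proof -
  have "continuous_on {0..T} (\<lambda>t. (t, x t, x (t - \<tau>)))"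
    using tau by (intro continuous_intros continuous_on_compose2[OF x_continuous]) auto
  then have "continuous_on {0..T} (\<lambda>t. (\<lambda>(t, u, z). f t u z) (t, x t, x (t - \<tau>)))"
    by (rule continuous_on_compose2[OF f_continuous]) auto
  then show ?thesis by (simp add: xdot_def[abs_def])
qed

lemma xdot_has_integral:
  assumes "0 \<le> u" "u \<le> v" "v \<le> T"
  shows "(xdot has_integral x v - x u) {u..v}"
proof -
  from sol have "AE t in lebesgue_on {0..T}. (x has_vector_derivative xdot t) (at t within {0..T})"
    by (simp add: dde_solution_def xdot_def)
  then obtain N where N: "N \<in> null_sets (lebesgue_on {0..T})"
    "{t \<in> space (lebesgue_on {0..T}). \<not> (x has_vector_derivative xdot t) (at t within {0..T})} \<subseteq> N"
    unfolding eventually_ae_filter by blast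
  have "negligible N"
    using N(1) by (simp add: negligible_iff_null_sets null_sets_restrict_space)
  moreover have "absolutely_continuous_fun_on {u..v} x"
  proof (rule absolutely_continuous_fun_on_subset)
    show "absolutely_continuous_fun_on {0..T} x" using sol unfolding dde_solution_def by blast
    show "{u..v} \<subseteq> {0..T}" using assms by simp
  qed
  moreover have "(x has_vector_derivative xdot t) (at t within {u..v})" if "t \<in> {u..v} - N" for t
  proof (rule has_vector_derivative_within_subset)
    have "t \<in> space (lebesgue_on {0..T})" using that assms by simp
    then show "(x has_vector_derivative xdot t) (at t within {0..T})" using N(2) that by blast
    show "{u..v} \<subseteq> {0..T}" using assms by auto
  qed
  ultimately show ?thesis using assms by (intro has_integral_absolutely_continuous) auto
qed

text \<open>Continuity of \<open>xdot\<close> upgrades the almost everywhere equation to every t,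
  because x is the integral of a continuous function.\<close>

lemma x_has_vector_derivative:
  assumes "t \<in> {0..T}"
  shows "(x has_vector_derivative xdot t) (at t within {0..T})"
proof -
  have der: "((\<lambda>u. x 0 + integral {0..u} xdot) has_vector_derivative 0 + xdot t) (at t within {0..T})"
    by (intro has_vector_derivative_add integral_has_vector_derivative xdot_continuous assms) simp
  have eq: "x u = x 0 + integral {0..u} xdot" if "u \<in> {0..T}" for u
    using integral_unique[OF xdot_has_integral[of 0 u]] that by simp
  have "(x has_vector_derivative 0 + xdot t) (at t within {0..T})"
    by (rule has_vector_derivative_transform[OF assms eq der])
  then show ?thesis by simp
qed

lemma xdot_bounded: obtains G where "0 \<le> G" "\<And>t. t \<in> {0..T} \<Longrightarrow> norm (xdot t) \<le> G"
proof -
  have "bounded (xdot ` {0..T})"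
    by (intro compact_imp_bounded compact_continuous_image xdot_continuous) simp
  then obtain G where "\<And>t. t \<in> {0..T} \<Longrightarrow> norm (xdot t) \<le> G"
    unfolding bounded_iff by blast
  then show ?thesis using that[of "max 0 G"] by force
qed

text \<open>Stated from -\<tau> on, because the delayed argument reaches back into the initial
  segment; an increment across 0 is split at 0.\<close>

lemma x_lipschitz:
  obtains A where "0 \<le> A"
    "\<And>s t. s \<in> {-\<tau>..T} \<Longrightarrow> t \<in> {-\<tau>..T} \<Longrightarrow> norm (x t - x s) \<le> A * \<bar>t - s\<bar>"
proof -
  obtain G where G: "0 \<le> G" "\<And>t. t \<in> {0..T} \<Longrightarrow> norm (xdot t) \<le> G" by (rule xdot_bounded) blast
  have pos: "norm (x t - x s) \<le> G * (t - s)" if "0 \<le> s" "s \<le> t" "t \<le> T" for s t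
    using has_integral_bound_real[OF G(1) finite.emptyI xdot_has_integral[OF that]] G(2) that by auto
  have neg: "norm (x t - x s) \<le> L * (t - s)" if "-\<tau> \<le> s" "s \<le> t" "t \<le> 0" for s t
    using phi_lip[of s t] that by (simp add: x_eq_phi)
  have ord: "norm (x t - x s) \<le> (G + L) * (t - s)" if st: "-\<tau> \<le> s" "s \<le> t" "t \<le> T" for s t
  proof -
    have g: "0 \<le> G * (t - s)" "0 \<le> L * (t - s)" using G L st by auto
    consider "0 \<le> s" | "t \<le> 0" | "s < 0" "0 < t" by linarith
    then show ?thesis
    proof cases
      case 3
      have "norm (x t - x s) \<le> norm (x t - x 0) + norm (x 0 - x s)"
        by (rule order_trans[OF _ norm_triangle_ineq]) simp
      also have "\<dots> \<le> G * (t - 0) + L * (0 - s)"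
        using 3 st by (intro add_mono pos neg) auto
      also have "\<dots> \<le> G * (t - s) + L * (t - s)"
        using 3 G L by (intro add_mono mult_left_mono) auto
      finally show ?thesis by (simp add: algebra_simps)
    qed (use pos[of s t] neg[of s t] st g in \<open>auto simp: algebra_simps\<close>)
  qed
  have "norm (x t - x s) \<le> (G + L) * \<bar>t - s\<bar>" if "s \<in> {-\<tau>..T}" "t \<in> {-\<tau>..T}" for s t
    using ord[of s t] ord[of t s] that by (cases "s \<le> t") (auto simp: norm_minus_commute)
  then show ?thesis using that[of "G + L"] G L by auto
qed

text \<open>The current state contributes the exponent 1, the delayed state \<alpha>, and time
  \<gamma>. All three are at least \<mu>, and for distances up to 1 a larger exponent may be lowered
  to \<mu>.\<close>

lemma xdot_holder:
  obtains H where "0 < H"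
    "\<And>s t. s \<in> {0..T} \<Longrightarrow> t \<in> {0..T} \<Longrightarrow> \<bar>t - s\<bar> \<le> 1 \<Longrightarrow> norm (xdot t - xdot s) \<le> H * \<bar>t - s\<bar> powr \<mu>"
proof -
  obtain A where A: "0 \<le> A"
    "\<And>s t. s \<in> {-\<tau>..T} \<Longrightarrow> t \<in> {-\<tau>..T} \<Longrightarrow> norm (x t - x s) \<le> A * \<bar>t - s\<bar>" by (rule x_lipschitz) blast
  have "bounded (x ` {-\<tau>..T})"
    by (intro compact_imp_bounded compact_continuous_image x_continuous) simp
  then obtain B where B: "\<And>t. t \<in> {-\<tau>..T} \<Longrightarrow> norm (x t) \<le> B"
    unfolding bounded_iff by blast
  have "0 \<le> B" using order_trans[OF norm_ge_zero B[of 0]] tau T_pos by simp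
  \<comment> \<open>The summand 1 makes the constant strictly positive, as the moment bound for sums
    of quadrature errors demands of its size parameter \<open>c\<close>.\<close>
  have "norm (xdot t - xdot s) \<le> (L * (A + A powr \<alpha>) + L * (1 + B + B) + 1) * \<bar>t - s\<bar> powr \<mu>"
    if st: "s \<in> {0..T}" "t \<in> {0..T}" "\<bar>t - s\<bar> \<le> 1" for s t
  proof -
    let ?d = "\<bar>t - s\<bar>"
    have pw: "?d powr c \<le> ?d powr \<mu>" if "\<mu> \<le> c" for c
      using powr_mono'[OF that, of ?d] st by auto
    have st': "s - \<tau> \<in> {-\<tau>..T}" "t - \<tau> \<in> {-\<tau>..T}" "s \<in> {-\<tau>..T}" "t \<in> {-\<tau>..T}"
      using st tau by auto
    have x1: "norm (x t - x s) \<le> A * ?d powr \<mu>"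
    proof -
      have "?d \<le> ?d powr \<mu>" using pw[of 1] mu by (cases "?d = 0") auto
      then show ?thesis using A(2)[OF st'(3,4)] A(1) by (meson mult_left_mono order_trans)
    qed
    have x2: "norm (x (t - \<tau>) - x (s - \<tau>)) powr \<alpha> \<le> A powr \<alpha> * ?d powr \<mu>"
    proof -
      have "norm (x (t - \<tau>) - x (s - \<tau>)) powr \<alpha> \<le> (A * ?d) powr \<alpha>"
        using A(2)[OF st'(1,2)] al by (intro powr_mono2) auto
      also have "\<dots> = A powr \<alpha> * ?d powr \<alpha>" using A by (simp add: powr_mult)
      also have "\<dots> \<le> A powr \<alpha> * ?d powr \<mu>" using pw mu by (intro mult_left_mono) auto
      finally show ?thesis .
    qed
    have "norm (xdot t - xdot s) \<le> norm (f t (x t) (x (t - \<tau>)) - f t (x s) (x (s - \<tau>)))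
        + norm (f t (x s) (x (s - \<tau>)) - f s (x s) (x (s - \<tau>)))"
      unfolding xdot_def by (rule order_trans[OF _ norm_triangle_ineq]) simp
    also have "\<dots> \<le> L * (norm (x t - x s) + norm (x (t - \<tau>) - x (s - \<tau>)) powr \<alpha>)
        + L * (1 + norm (x s) + norm (x (s - \<tau>))) * ?d powr \<gamma>"
      by (intro add_mono f_lip f_time st)
    also have "\<dots> \<le> L * (A * ?d powr \<mu> + A powr \<alpha> * ?d powr \<mu>) + L * (1 + B + B) * ?d powr \<mu>"
      using x1 x2 L B[OF st'(3)] B[OF st'(1)] pw[OF mu(4)] \<open>0 \<le> B\<close>
      by (intro add_mono mult_mono) auto
    also have "\<dots> \<le> (L * (A + A powr \<alpha>) + L * (1 + B + B) + 1) * ?d powr \<mu>"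
      by (simp add: algebra_simps)
    finally show ?thesis .
  qed
  moreover have "0 < L * (A + A powr \<alpha>) + L * (1 + B + B) + 1"
    using L A \<open>0 \<le> B\<close> by (intro add_nonneg_pos add_nonneg_nonneg mult_nonneg_nonneg) auto
  ultimately show ?thesis using that by blast
qed

end

section \<open>Pathwise error of the scheme\<close>

lemma discrete_gronwall:
  fixes u :: "nat \<Rightarrow> real"
  assumes "0 \<le> a" "0 \<le> b" and u: "\<And>k. k \<le> N \<Longrightarrow> u k \<le> a + b * (\<Sum>i<k. u i)" and k: "k \<le> N"
  shows "u k \<le> a * exp (b * real k)"
proof -
  have "u k \<le> a * (1 + b) ^ k" using k
  proof (induction k rule: less_induct)
    case (less k)
    have "u k \<le> a + b * (\<Sum>i<k. u i)" using u less.prems by simp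
    also have "\<dots> \<le> a + b * (\<Sum>i<k. a * (1 + b) ^ i)"
      using less assms by (intro add_left_mono mult_left_mono sum_mono) auto
    also have "\<dots> = a * (1 + b) ^ k"
    proof -
      have "1 + b * (\<Sum>i<k. (1 + b) ^ i) = (1 + b) ^ k"
        using one_diff_power_eq[of "1 + b" k] by simp
      then have "a * (1 + b) ^ k = a * (1 + b * (\<Sum>i<k. (1 + b) ^ i))" by simp
      then show ?thesis by (simp add: sum_distrib_left[symmetric] algebra_simps)
    qed
    finally show ?case .
  qed
  also have "\<dots> \<le> a * exp b ^ k"
    using assms exp_ge_add_one_self[of b] by (intro mult_left_mono power_mono) auto
  finally show ?thesis by (simp add: mult.commute flip: exp_of_nat_mult)
qed

text \<open>After division by \<open>a + b\<close> both terms lie in [0,1], where u <= u powr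
  c.\<close>

lemma powr_add_le_add_powr:
  fixes a b c :: real
  assumes "0 \<le> a" "0 \<le> b" "0 < c" "c \<le> 1"
  shows "(a + b) powr c \<le> a powr c + b powr c"
proof (cases "a + b = 0")
  case False
  then have s: "0 < a + b" using assms by simp
  have *: "u / (a + b) \<le> (u / (a + b)) powr c" if "0 \<le> u" "u \<le> a + b" for u
    using powr_mono'[of c 1 "u / (a + b)"] that assms s by (cases "u = 0") auto
  have "1 = a / (a + b) + b / (a + b)" using s by (simp add: add_divide_distrib[symmetric])
  also have "\<dots> \<le> (a / (a + b)) powr c + (b / (a + b)) powr c"
    using assms by (intro add_mono *) auto
  also have "\<dots> = (a powr c + b powr c) / (a + b) powr c"
    using assms s by (simp add: powr_divide add_divide_distrib)
  finally show ?thesis using s by (simp add: field_simps)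
qed (use assms in auto)

lemma tgrid_0_Suc: "0 < N \<Longrightarrow> tgrid \<tau> N (int (Suc j)) 0 = tgrid \<tau> N (int j) N"
  by (simp add: tgrid_def algebra_simps)

lemma tgrid_Suc: "tgrid \<tau> N j (Suc k) = tgrid \<tau> N j k + \<tau> / real N"
  by (simp add: tgrid_def algebra_simps add_divide_distrib)

lemma tgrid_shift: "tgrid \<tau> N j k - \<tau> = tgrid \<tau> N (j - 1) k"
  by (simp add: tgrid_def algebra_simps)

section \<open>Propagation of the error over one interval\<close>

context dde_holder
begin

text \<open>The node \<open>c\<close> is left free: c = t gives the local error of the Euler
  predictor, and a random node in the step gives the size of one quadrature error.\<close>

lemma xdot_taylor:
  assumes H: "0 \<le> H" "\<And>s t. s \<in> {0..T} \<Longrightarrow> t \<in> {0..T} \<Longrightarrow> \<bar>t - s\<bar> \<le> 1 \<Longrightarrow>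
      norm (xdot t - xdot s) \<le> H * \<bar>t - s\<bar> powr \<mu>"
    and t: "0 \<le> t" "t + s \<le> T" "0 \<le> s" "s \<le> 1" and c: "c \<in> {t..t+s}"
  shows "norm (x (t + s) - x t - s *\<^sub>R xdot c) \<le> H * s powr (1 + \<mu>)"
proof -
  have "((\<lambda>r. xdot r - xdot c) has_integral (x (t + s) - x t) - s *\<^sub>R xdot c) {t..t+s}"
    using has_integral_diff[OF xdot_has_integral[of t "t + s"] has_integral_const_real[of "xdot c" t "t + s"]] t
    by simp
  moreover have "norm (xdot r - xdot c) \<le> H * s powr \<mu>" if "r \<in> {t..t+s}" for r
  proof -
    have "norm (xdot r - xdot c) \<le> H * \<bar>r - c\<bar> powr \<mu>"
      by (rule H(2)) (use that t c in auto)
    also have "\<dots> \<le> H * s powr \<mu>"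
      using that c H(1) mu by (intro mult_left_mono powr_mono2) auto
    finally show ?thesis .
  qed
  ultimately have "norm ((x (t + s) - x t) - s *\<^sub>R xdot c) \<le> H * s powr \<mu> * measure lborel {t..t+s}"
    using H(1) by (intro has_integral_bound_real[where S = "{}" and f = "\<lambda>r. xdot r - xdot c"]) auto
  also have "\<dots> = H * s powr (1 + \<mu>)" using t by (cases "s = 0") (auto simp: powr_add)
  finally show ?thesis .
qed

text \<open>Serves both predictors of a step: the one on the current interval and, with all times
  moved back by \<tau>, the one for the delayed stage.\<close>

lemma stage_error:
  assumes H: "0 \<le> H" "\<And>s t. s \<in> {0..T} \<Longrightarrow> t \<in> {0..T} \<Longrightarrow> \<bar>t - s\<bar> \<le> 1 \<Longrightarrow>
      norm (xdot t - xdot s) \<le> H * \<bar>t - s\<bar> powr \<mu>"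
    and t: "0 \<le> t" "t + s \<le> T" "0 \<le> s" "s \<le> h" "h \<le> 1"
  shows "norm (x (t + s) - (y + s *\<^sub>R f t y z))
    \<le> (1 + h * L) * norm (x t - y) + h * L * norm (x (t - \<tau>) - z) powr \<alpha> + H * h powr (1 + \<mu>)"
proof -
  have "x (t + s) - (y + s *\<^sub>R f t y z) = (x (t + s) - x t - s *\<^sub>R xdot t) + (x t - y) + s *\<^sub>R (xdot t - f t y z)"
    by (simp add: algebra_simps)
  also have "norm \<dots> \<le> norm (x (t + s) - x t - s *\<^sub>R xdot t) + norm (x t - y) + s * norm (xdot t - f t y z)"
    using t by (intro order_trans[OF norm_triangle_ineq] add_mono) auto
  also have "norm (x (t + s) - x t - s *\<^sub>R xdot t) \<le> H * s powr (1 + \<mu>)"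
    using t by (intro xdot_taylor[OF H]) auto
  also have "H * s powr (1 + \<mu>) \<le> H * h powr (1 + \<mu>)"
    using t H mu by (intro mult_left_mono powr_mono2) auto
  also have "s * norm (xdot t - f t y z) \<le> h * (L * (norm (x t - y) + norm (x (t - \<tau>) - z) powr \<alpha>))"
    unfolding xdot_def using t by (intro mult_mono f_lip) auto
  finally show ?thesis by (simp add: algebra_simps)
qed

text \<open>The node is inserted into the exact derivative, not into f along the numerical path.
  Thus only \<open>r (Suc i)\<close> enters, and different steps use different random
  variables.\<close>

definition quad_err where
  "quad_err N r j i = x (tgrid \<tau> N (int j) (Suc i)) - x (tgrid \<tau> N (int j) i)
    - (\<tau> / real N) *\<^sub>R xdot (tgrid \<tau> N (int j) i + \<tau> / real N * r (Suc i))"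

definition max_quad_err where
  "max_quad_err N r j = Max ((\<lambda>k. norm (\<Sum>i<k. quad_err N r j i)) ` {..N})"

text \<open>Indexed like \<open>rk_shifted\<close>: J = 0 is the initial segment, and the j-th
  interval has J = Suc j.\<close>

definition rk_err where
  "rk_err N g J = Max ((\<lambda>i. norm (x (tgrid \<tau> N (int J - 1) i) - rk_shifted f \<phi> \<tau> N g J i)) ` {0..N})"

lemma rk_err_ge: "i \<le> N \<Longrightarrow> norm (x (tgrid \<tau> N (int J - 1) i) - rk_shifted f \<phi> \<tau> N g J i) \<le> rk_err N g J"
  unfolding rk_err_def by (intro Max_ge) auto

lemma rk_err_le:
  "(\<And>i. i \<le> N \<Longrightarrow> norm (x (tgrid \<tau> N (int J - 1) i) - rk_shifted f \<phi> \<tau> N g J i) \<le> c) \<Longrightarrow> rk_err N g J \<le> c"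
  unfolding rk_err_def by (intro Max.boundedI) auto

lemma rk_err_nonneg: "0 \<le> rk_err N g J"
  by (rule order_trans[OF norm_ge_zero rk_err_ge[of 0]]) simp

lemma max_quad_err_nonneg: "0 \<le> max_quad_err N r j"
  unfolding max_quad_err_def
  by (rule order_trans[OF norm_ge_zero[of "\<Sum>i<0. quad_err N r j i"] Max_ge]) (blast intro: finite_imageI)+

lemma rk_err_0: "rk_err N g 0 = 0"
proof -
  have "tgrid \<tau> N (- 1) i \<in> {-\<tau>..0}" if "i \<le> N" for i
    using that tau mult_left_mono[of "real i / real N" 1 \<tau>]
    by (auto simp: tgrid_def divide_le_eq mult.commute)
  then have "rk_err N g 0 \<le> 0" by (intro rk_err_le) (simp add: x_eq_phi)
  then show ?thesis using rk_err_nonneg[of N g 0] by simp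
qed

lemma tgrid_bounds:
  assumes "j \<le> n" "k \<le> N" "0 < N"
  shows "0 \<le> tgrid \<tau> N (int j) k" "tgrid \<tau> N (int j) k \<le> T"
proof -
  show "0 \<le> tgrid \<tau> N (int j) k" using tau by (simp add: tgrid_def)
  have "real k * (\<tau> / real N) \<le> 1 * \<tau>" using assms tau by (auto simp: field_simps)
  moreover have "real j * \<tau> \<le> real n * \<tau>" using assms tau by simp
  ultimately show "tgrid \<tau> N (int j) k \<le> T" by (simp add: tgrid_def algebra_simps)
qed

text \<open>The delayed values \<open>z\<close> and \<open>zt\<close> are arbitrary sequences with
  error bounds \<open>A\<close> and \<open>B\<close>. This treats the first interval, where the
  delayed stage is a value of \<phi>, and the later ones, where it is predicted, by one argument:
  telescope the error, then apply Gronwall.\<close>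

lemma interval_error:
  fixes y z zt :: "nat \<Rightarrow> 'a" and r :: "nat \<Rightarrow> real"
  assumes H: "0 \<le> H" "\<And>s t. s \<in> {0..T} \<Longrightarrow> t \<in> {0..T} \<Longrightarrow> \<bar>t - s\<bar> \<le> 1 \<Longrightarrow>
      norm (xdot t - xdot s) \<le> H * \<bar>t - s\<bar> powr \<mu>"
    and N: "0 < N" "\<tau> \<le> real N" and j: "j \<le> n"
    and r: "\<And>k. r (Suc k) \<in> {0..1}"
    and h: "h = \<tau> / real N" and tk: "\<And>k. t k = tgrid \<tau> N (int j) k"
    and y: "\<And>k. k < N \<Longrightarrow> y (Suc k) = y k + h *\<^sub>R f (t k + h * r (Suc k))
        (y k + (h * r (Suc k)) *\<^sub>R f (t k) (y k) (z k)) (zt k)"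
    and A: "\<And>k. k < N \<Longrightarrow> norm (x (t k - \<tau>) - z k) \<le> A"
    and B: "\<And>k. k < N \<Longrightarrow> norm (x (t k + h * r (Suc k) - \<tau>) - zt k) \<le> B"
    and k: "k \<le> N"
  shows "norm (x (t k) - y k) \<le> exp (\<tau> * (L * (1 + L))) *
    (norm (x (t 0) - y 0) + max_quad_err N r j + \<tau> * (L * (L * A powr \<alpha> + H * h powr (1 + \<mu>) + B powr \<alpha>)))"
proof -
  have h01: "0 < h" "h \<le> 1" and hN: "h * real N = \<tau>" using N tau h by auto
  have A0: "0 \<le> A" "0 \<le> B" using order_trans[OF norm_ge_zero A[OF N(1)]] order_trans[OF norm_ge_zero B[OF N(1)]] .
  define e where "e k = x (t k) - y k" for k
  \<comment> \<open>Exact minus numerical slope, both at the random node. The step error is then a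
    quadrature error plus \<open>h *\<^sub>R d i\<close>.\<close>
  define d where "d i = xdot (t i + h * r (Suc i)) - f (t i + h * r (Suc i))
        (y i + (h * r (Suc i)) *\<^sub>R f (t i) (y i) (z i)) (zt i)" for i
  \<comment> \<open>The part of the slope error that does not involve the error on the current
    interval.\<close>
  define R where "R = L * (L * A powr \<alpha> + H * h powr (1 + \<mu>) + B powr \<alpha>)"
  have R: "0 \<le> R" using L H(1) by (auto simp: R_def)
  have e_sum: "e k = e 0 + (\<Sum>i<k. quad_err N r j i) + h *\<^sub>R (\<Sum>i<k. d i)" if "k \<le> N" for k
    using that
  proof (induction k)
    case (Suc k)
    have "e (Suc k) = e k + quad_err N r j k + h *\<^sub>R d k"
      using Suc.prems y[of k] by (simp add: e_def quad_err_def d_def tk h algebra_simps)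
    then show ?case using Suc by (simp add: algebra_simps)
  qed simp
  have d: "norm (d i) \<le> L * (1 + L) * norm (e i) + R" if i: "i < N" for i
  proof -
    have hr: "0 \<le> h * r (Suc i)" "h * r (Suc i) \<le> h" using r[of i] h01 by (auto simp: mult_left_le)
    have ti: "0 \<le> t i" "t i + h \<le> T"
      using tgrid_bounds[OF j, of i N] tgrid_bounds[OF j, of "Suc i" N] i N by (auto simp: tk h tgrid_Suc)
    have tr: "t i + h * r (Suc i) \<le> T" using ti hr by linarith
    have "norm (d i) \<le> L * (norm (x (t i + h * r (Suc i)) - (y i + (h * r (Suc i)) *\<^sub>R f (t i) (y i) (z i)))
        + norm (x (t i + h * r (Suc i) - \<tau>) - zt i) powr \<alpha>)"
      unfolding d_def xdot_def using ti hr by (intro f_lip) (simp only: atLeastAtMost_iff; linarith)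
    also have "\<dots> \<le> L * (((1 + h * L) * norm (e i) + h * L * A powr \<alpha> + H * h powr (1 + \<mu>)) + B powr \<alpha>)"
    proof (intro mult_left_mono add_mono L)
      have "norm (x (t i + h * r (Suc i)) - (y i + (h * r (Suc i)) *\<^sub>R f (t i) (y i) (z i)))
        \<le> (1 + h * L) * norm (x (t i) - y i) + h * L * norm (x (t i - \<tau>) - z i) powr \<alpha> + H * h powr (1 + \<mu>)"
        using ti(1) tr hr h01(2) by (intro stage_error[OF H])
      also have "\<dots> \<le> (1 + h * L) * norm (x (t i) - y i) + h * L * A powr \<alpha> + H * h powr (1 + \<mu>)"
        using A[OF i] al L h01 by (intro add_mono order_refl mult_left_mono powr_mono2) auto
      finally show "norm (x (t i + h * r (Suc i)) - (y i + (h * r (Suc i)) *\<^sub>R f (t i) (y i) (z i)))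
        \<le> (1 + h * L) * norm (e i) + h * L * A powr \<alpha> + H * h powr (1 + \<mu>)" by (simp add: e_def)
      show "norm (x (t i + h * r (Suc i) - \<tau>) - zt i) powr \<alpha> \<le> B powr \<alpha>"
        using B[OF i] al by (intro powr_mono2) auto
    qed
    \<comment> \<open>Here h <= 1 removes the factors h; this is where \<open>L * (1 + L)\<close> in
      the Gronwall exponent comes from.\<close>
    also have "\<dots> \<le> L * (((1 + L) * norm (e i) + L * A powr \<alpha> + H * h powr (1 + \<mu>)) + B powr \<alpha>)"
      using h01 L by (intro mult_left_mono add_mono mult_right_mono) (auto intro: mult_left_le_one_le)
    finally show ?thesis by (simp add: R_def algebra_simps)
  qed
  let ?a = "norm (e 0) + max_quad_err N r j + \<tau> * R" and ?b = "h * (L * (1 + L))"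
  have step: "norm (e k) \<le> ?a + ?b * (\<Sum>i<k. norm (e i))" if k: "k \<le> N" for k
  proof -
    have "norm (e k) \<le> norm (e 0) + norm (\<Sum>i<k. quad_err N r j i) + h * norm (\<Sum>i<k. d i)"
      unfolding e_sum[OF k] using h01 by (intro order_trans[OF norm_triangle_ineq] add_mono) auto
    also have "norm (\<Sum>i<k. quad_err N r j i) \<le> max_quad_err N r j"
      unfolding max_quad_err_def using k by (intro Max_ge) auto
    also have "h * norm (\<Sum>i<k. d i) \<le> h * (\<Sum>i<k. L * (1 + L) * norm (e i) + R)"
      using d k h01 by (intro mult_left_mono sum_norm_le) auto
    also have "\<dots> = ?b * (\<Sum>i<k. norm (e i)) + h * real k * R"
      by (simp add: sum.distrib sum_distrib_left[symmetric] algebra_simps)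
    also have "h * real k * R \<le> \<tau> * R"
      using k h01 R by (intro mult_right_mono) (auto simp flip: hN)
    finally show ?thesis by simp
  qed
  have "norm (e k) \<le> ?a * exp (?b * real k)"
    by (rule discrete_gronwall[OF _ _ step k])
       (use R tau max_quad_err_nonneg L h01 in auto)
  also have "\<dots> \<le> ?a * exp (?b * real N)"
    using k R tau max_quad_err_nonneg[of N r j] L h01 by (intro mult_left_mono) (auto intro!: mult_left_mono)
  also have "?b * real N = \<tau> * (L * (1 + L))"
    unfolding hN[symmetric] by (simp add: algebra_simps)
  finally show ?thesis by (simp add: e_def R_def mult.commute)
qed

text \<open>The sources of the terms: \<open>rk_err N g (Suc i)\<close> appears linearly through the
  starting value of the interval, and with power \<alpha> through the delayed grid value and the
  delayed stage. The predictor of the delayed stage has an error containing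
  \<open>rk_err N g i powr \<alpha>\<close> and a local part h^(1+\<mu>); f raises both to the power
  \<alpha> once more.\<close>

lemma pathwise_error:
  obtains D where "0 < D"
    "\<And>N g. \<tau> \<le> real N \<Longrightarrow> (\<And>j k. g j (Suc k) \<in> {0..1}) \<Longrightarrow>
      rk_err N g (Suc 0) \<le> D * (max_quad_err N (g 0) 0 + (\<tau> / real N) powr (1 + \<mu>))"
    "\<And>N g i. \<tau> \<le> real N \<Longrightarrow> (\<And>j k. g j (Suc k) \<in> {0..1}) \<Longrightarrow> Suc i \<le> n \<Longrightarrow>
      rk_err N g (Suc (Suc i)) \<le> D * (max_quad_err N (g (Suc i)) (Suc i) + rk_err N g (Suc i)
        + rk_err N g (Suc i) powr \<alpha> + rk_err N g i powr (\<alpha>\<^sup>2) + (\<tau> / real N) powr (\<alpha> * (1 + \<mu>)))"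
proof -
  obtain H where H0: "0 < H" and H2: "\<And>s t. s \<in> {0..T} \<Longrightarrow> t \<in> {0..T} \<Longrightarrow> \<bar>t - s\<bar> \<le> 1 \<Longrightarrow>
    norm (xdot t - xdot s) \<le> H * \<bar>t - s\<bar> powr \<mu>" by (rule xdot_holder) blast
  have H: "0 \<le> H" using H0 by simp
  \<comment> \<open>\<open>K\<close> dominates the three coefficients 1 + h L, h L and H of
    \<open>stage_error\<close>; \<open>W\<close> collects the factors of the inhomogeneity once the
    error of the delayed stage is inserted, and \<open>E\<close> is the Gronwall factor.\<close>
  define K where "K = 1 + L + H"
  define W where "W = \<tau> * (L * (L + H + K))"
  define E where "E = exp (\<tau> * (L * (1 + L)))"
  have K: "1 \<le> K" "L \<le> K" "H \<le> K" "1 + L \<le> K" using H L by (auto simp: K_def)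
  have W: "0 \<le> W" using K L H tau by (auto simp: W_def)
  have E: "0 < E" by (simp add: E_def)
  have 1: "rk_err N g (Suc 0) \<le> E * (1 + W) * (max_quad_err N (g 0) 0 + (\<tau> / real N) powr (1 + \<mu>))"
    if N: "\<tau> \<le> real N" and g: "\<And>j k. g j (Suc k) \<in> {0..1}" for N g
  proof (rule rk_err_le)
    fix k assume k: "k \<le> N"
    have N0: "0 < N" using N tau by (cases N) auto
    let ?h = "\<tau> / real N" and ?t = "tgrid \<tau> N (int 0)"
    have h: "0 < ?h" "?h \<le> 1" using N N0 tau by auto
    have m1: "?t i - \<tau> = tgrid \<tau> N (- 1) i" for i by (simp add: tgrid_def)
    have in1: "tgrid \<tau> N (- 1) i + ?h * s \<in> {-\<tau>..0}" if "i < N" "s \<in> {0..1}" for i s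
    proof -
      have "(real i + s) * ?h \<le> real N * ?h" using that h by (intro mult_right_mono) auto
      moreover have "0 \<le> (real i + s) * ?h" using that h by (intro mult_nonneg_nonneg) auto
      moreover have "tgrid \<tau> N (- 1) i + ?h * s = - \<tau> + (real i + s) * ?h"
        by (simp add: tgrid_def add_divide_distrib algebra_simps)
      moreover have "real N * ?h = \<tau>" using N0 by simp
      ultimately show ?thesis unfolding atLeastAtMost_iff by linarith
    qed
    \<comment> \<open>On the first interval both delayed arguments are exact values of \<phi>, so
      the bounds are A = B = 0, and \<open>0 powr \<alpha>\<close> is 0.\<close>
    have "norm (x (?t k) - rk_shifted f \<phi> \<tau> N g (Suc 0) k) \<le> E *
      (norm (x (?t 0) - rk_shifted f \<phi> \<tau> N g (Suc 0) 0) + max_quad_err N (g 0) 0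
        + \<tau> * (L * (L * 0 powr \<alpha> + H * ?h powr (1 + \<mu>) + 0 powr \<alpha>)))"
      unfolding E_def
    proof (rule interval_error[where N = N and j = 0 and h = ?h and t = ?t and r = "g 0"
          and y = "rk_shifted f \<phi> \<tau> N g (Suc 0)" and z = "rk_shifted f \<phi> \<tau> N g 0"
          and zt = "\<lambda>i. \<phi> (tgrid \<tau> N (- 1) i + ?h * g 0 (Suc i))",
          OF H H2 N0 N _ g refl refl _ _ _ k])
      show "norm (x (?t i - \<tau>) - rk_shifted f \<phi> \<tau> N g 0 i) \<le> 0" if "i < N" for i
        unfolding m1 using in1[OF that, of 0] by (simp add: x_eq_phi)
      show "norm (x (?t i + ?h * g 0 (Suc i) - \<tau>) - \<phi> (tgrid \<tau> N (- 1) i + ?h * g 0 (Suc i))) \<le> 0" if "i < N" for i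
      proof -
        have eq: "?t i + ?h * g 0 (Suc i) - \<tau> = tgrid \<tau> N (- 1) i + ?h * g 0 (Suc i)"
          by (simp add: tgrid_def)
        show ?thesis unfolding eq using x_eq_phi[OF in1[OF that g[of 0 i]]] by simp
      qed
    qed (simp_all add: Let_def)
    also have "x (?t 0) - rk_shifted f \<phi> \<tau> N g (Suc 0) 0 = 0"
    proof -
      have "tgrid \<tau> N (- 1) N = 0" "tgrid \<tau> N 0 0 = 0" using N0 by (simp_all add: tgrid_def)
      then show ?thesis using x_eq_phi[of 0] tau by simp
    qed
    also have "E * (norm (0::'a) + max_quad_err N (g 0) 0 + \<tau> * (L * (L * 0 powr \<alpha> + H * ?h powr (1 + \<mu>) + 0 powr \<alpha>)))
      = E * (max_quad_err N (g 0) 0 + \<tau> * (L * H) * ?h powr (1 + \<mu>))"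
      by simp
    also have "\<dots> \<le> E * ((1 + W) * max_quad_err N (g 0) 0 + (1 + W) * ?h powr (1 + \<mu>))"
    proof (intro mult_left_mono add_mono mult_right_mono)
      have "\<tau> * (L * H) \<le> W" unfolding W_def using tau L K by (intro mult_left_mono) auto
      then show "\<tau> * (L * H) \<le> 1 + W" by simp
      show "max_quad_err N (g 0) 0 \<le> (1 + W) * max_quad_err N (g 0) 0"
        using W max_quad_err_nonneg[of N "g 0" 0] by (simp add: algebra_simps)
    qed (use E in auto)
    finally show "norm (x (tgrid \<tau> N (int (Suc 0) - 1) k) - rk_shifted f \<phi> \<tau> N g (Suc 0) k)
      \<le> E * (1 + W) * (max_quad_err N (g 0) 0 + ?h powr (1 + \<mu>))"
      by (simp add: algebra_simps)
  qed
  have 2: "rk_err N g (Suc (Suc i)) \<le> E * (1 + W) * (max_quad_err N (g (Suc i)) (Suc i) + rk_err N g (Suc i)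
        + rk_err N g (Suc i) powr \<alpha> + rk_err N g i powr (\<alpha>\<^sup>2) + (\<tau> / real N) powr (\<alpha> * (1 + \<mu>)))"
    if N: "\<tau> \<le> real N" and g: "\<And>j k. g j (Suc k) \<in> {0..1}" and i: "Suc i \<le> n" for N g i
  proof (rule rk_err_le)
    fix k assume k: "k \<le> N"
    have N0: "0 < N" using N tau by (cases N) auto
    let ?h = "\<tau> / real N" and ?t = "tgrid \<tau> N (int (Suc i))" and ?s = "tgrid \<tau> N (int i)"
    let ?y = "rk_shifted f \<phi> \<tau> N g (Suc (Suc i))" and ?z = "rk_shifted f \<phi> \<tau> N g (Suc i)"
      and ?w = "rk_shifted f \<phi> \<tau> N g i"
    let ?g = "g (Suc i)" and ?E1 = "rk_err N g (Suc i)" and ?E0 = "rk_err N g i"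
    let ?Q = "max_quad_err N (g (Suc i)) (Suc i)"
    have h: "0 < ?h" "?h \<le> 1" using N N0 tau by auto
    have ts: "?t l - \<tau> = ?s l" for l by (simp add: tgrid_shift)
    have pz: "norm (x (?s l) - ?z l) \<le> ?E1" if "l \<le> N" for l
      using rk_err_ge[OF that, of "Suc i" g] by simp
    have pw: "norm (x (?s l - \<tau>) - ?w l) \<le> ?E0" if "l \<le> N" for l
      using rk_err_ge[OF that, of i g] by (simp add: tgrid_shift)
    \<comment> \<open>The bound of \<open>stage_error\<close> on the previous interval, with all
      coefficients replaced by \<open>K\<close>.\<close>
    let ?B = "K * (?E1 + ?E0 powr \<alpha> + ?h powr (1 + \<mu>))"
    have nn: "0 \<le> ?E1" "0 \<le> ?E0" "0 \<le> ?Q" by (auto simp: rk_err_nonneg max_quad_err_nonneg)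
    have "norm (x (?t k) - ?y k) \<le> E *
      (norm (x (?t 0) - ?y 0) + ?Q + \<tau> * (L * (L * ?E1 powr \<alpha> + H * ?h powr (1 + \<mu>) + ?B powr \<alpha>)))"
      unfolding E_def
    proof (rule interval_error[where N = N and j = "Suc i" and h = ?h and t = ?t and r = ?g
          and y = ?y and z = ?z and zt = "\<lambda>l. ?z l + (?h * ?g (Suc l)) *\<^sub>R f (?s l) (?z l) (?w l)",
          OF H H2 N0 N i g refl refl _ _ _ k])
      show "norm (x (?t l - \<tau>) - ?z l) \<le> ?E1" if "l < N" for l
        unfolding ts using pz[of l] that by simp
      show "norm (x (?t l + ?h * ?g (Suc l) - \<tau>) - (?z l + (?h * ?g (Suc l)) *\<^sub>R f (?s l) (?z l) (?w l))) \<le> ?B" if l: "l < N" for l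
      proof -
        have hr: "0 \<le> ?h * ?g (Suc l)" "?h * ?g (Suc l) \<le> ?h"
          using g[of "Suc i" l] h mult_left_le[of "?g (Suc l)" ?h]
            mult_nonneg_nonneg[of ?h "?g (Suc l)"] by auto
        have sl: "0 \<le> ?s l" "?s l + ?h \<le> T"
          using tgrid_bounds[of i l N] tgrid_bounds[of i "Suc l" N] i l N0 by (auto simp: tgrid_Suc)
        have "?t l + ?h * ?g (Suc l) - \<tau> = ?s l + ?h * ?g (Suc l)" using ts[of l] by linarith
        moreover have "norm (x (?s l + ?h * ?g (Suc l)) - (?z l + (?h * ?g (Suc l)) *\<^sub>R f (?s l) (?z l) (?w l)))
          \<le> (1 + ?h * L) * norm (x (?s l) - ?z l) + ?h * L * norm (x (?s l - \<tau>) - ?w l) powr \<alpha> + H * ?h powr (1 + \<mu>)"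
          using sl hr h by (intro stage_error[OF H H2]) auto
        moreover have "\<dots> \<le> K * ?E1 + K * ?E0 powr \<alpha> + K * ?h powr (1 + \<mu>)"
        proof (intro add_mono mult_mono)
          have "?h * L \<le> L" using h L mult_right_mono[of ?h 1 L] by simp
          then show "1 + ?h * L \<le> K" "?h * L \<le> K" using K by auto
          show "norm (x (?s l - \<tau>) - ?w l) powr \<alpha> \<le> ?E0 powr \<alpha>"
            using pw[of l] l al by (intro powr_mono2) auto
        qed (use K pz[of l] l in auto)
        ultimately show ?thesis by (simp add: algebra_simps)
      qed
    qed (simp_all add: Let_def)
    also have "\<dots> \<le> E * ((1 + W) * (?Q + ?E1 + ?E1 powr \<alpha> + ?E0 powr (\<alpha>\<^sup>2) + ?h powr (\<alpha> * (1 + \<mu>))))"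
    proof (intro mult_left_mono)
      \<comment> \<open>The starting value is the last grid value of the previous interval, at the
        same time point.\<close>
      have e0: "norm (x (?t 0) - ?y 0) \<le> ?E1"
        using pz[of N] N0 by (simp add: tgrid_0_Suc del: of_nat_Suc)
      have hh: "?h powr (1 + \<mu>) \<le> ?h powr (\<alpha> * (1 + \<mu>))"
        using h al mu mult_right_mono[of \<alpha> 1 "1 + \<mu>"] by (intro powr_mono') auto
      have "?B powr \<alpha> = K powr \<alpha> * (?E1 + ?E0 powr \<alpha> + ?h powr (1 + \<mu>)) powr \<alpha>"
        using K nn by (simp add: powr_mult)
      \<comment> \<open>Since K >= 1, \<open>K powr \<alpha>\<close> is at most \<open>K\<close>;
        subadditivity of the power is then used twice.\<close>
      also have "\<dots> \<le> K * ((?E1 + ?E0 powr \<alpha>) powr \<alpha> + (?h powr (1 + \<mu>)) powr \<alpha>)"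
        using K nn al powr_mono[of \<alpha> 1 K] by (intro mult_mono powr_add_le_add_powr) auto
      also have "\<dots> \<le> K * ((?E1 powr \<alpha> + (?E0 powr \<alpha>) powr \<alpha>) + (?h powr (1 + \<mu>)) powr \<alpha>)"
        using K nn al by (intro mult_left_mono add_mono powr_add_le_add_powr) auto
      also have "\<dots> = K * (?E1 powr \<alpha> + ?E0 powr (\<alpha>\<^sup>2) + ?h powr (\<alpha> * (1 + \<mu>)))"
        by (simp add: powr_powr power2_eq_square mult.commute)
      finally have Ba: "?B powr \<alpha> \<le> K * (?E1 powr \<alpha> + ?E0 powr (\<alpha>\<^sup>2) + ?h powr (\<alpha> * (1 + \<mu>)))" .
      let ?X = "?E1 powr \<alpha> + ?E0 powr (\<alpha>\<^sup>2) + ?h powr (\<alpha> * (1 + \<mu>))"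
      have X: "?E1 powr \<alpha> \<le> ?X" by auto
      have hX: "?h powr (1 + \<mu>) \<le> ?X" by (rule order_trans[OF hh]) auto
      have "L * ?E1 powr \<alpha> + H * ?h powr (1 + \<mu>) + ?B powr \<alpha> \<le> L * ?X + H * ?X + K * ?X"
        using L H X hX Ba by (intro add_mono mult_left_mono)
      then have "\<tau> * (L * (L * ?E1 powr \<alpha> + H * ?h powr (1 + \<mu>) + ?B powr \<alpha>)) \<le> \<tau> * (L * (L * ?X + H * ?X + K * ?X))"
        using tau L by (intro mult_left_mono) auto
      also have "\<dots> = W * ?X" by (simp add: W_def algebra_simps)
      finally have "norm (x (?t 0) - ?y 0) + ?Q + \<tau> * (L * (L * ?E1 powr \<alpha> + H * ?h powr (1 + \<mu>) + ?B powr \<alpha>))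
        \<le> ?E1 + ?Q + W * ?X" using e0 by simp
      also have "\<dots> \<le> ?E1 + ?Q + W * (?E1 + ?Q) + ?X + W * ?X"
        using W nn by auto
      finally show "norm (x (?t 0) - ?y 0) + ?Q + \<tau> * (L * (L * ?E1 powr \<alpha> + H * ?h powr (1 + \<mu>) + ?B powr \<alpha>))
        \<le> (1 + W) * (?Q + ?E1 + ?E1 powr \<alpha> + ?E0 powr (\<alpha>\<^sup>2) + ?h powr (\<alpha> * (1 + \<mu>)))"
        by (simp add: algebra_simps)
    qed (use E in auto)
    finally show "norm (x (tgrid \<tau> N (int (Suc (Suc i)) - 1) k) - ?y k)
      \<le> E * (1 + W) * (?Q + ?E1 + ?E1 powr \<alpha> + ?E0 powr (\<alpha>\<^sup>2) + ?h powr (\<alpha> * (1 + \<mu>)))"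
      by (simp add: mult.assoc)
  qed
  have "0 < E * (1 + W)" using E W by simp
  then show thesis using that[of "E * (1 + W)"] 1 2 by blast
qed

end

section \<open>Moments of the error\<close>

text \<open>Completeness of the probability space enters here. On a null set the given nodes may
  leave the unit interval and f may be evaluated outside its domain; the error is then only almost
  surely equal to a measurable function.\<close>

lemma (in complete_measure) borel_measurable_cong_AE:
  assumes f: "f \<in> borel_measurable M" and eq: "AE w in M. f w = g w"
  shows "g \<in> borel_measurable M"
proof (rule measurableI)
  fix A :: "'b set" assume A: "A \<in> sets borel"
  show "g -` A \<inter> space M \<in> sets M"
  proof (rule in_sets_AE)
    show "AE w in M. w \<in> f -` A \<inter> space M \<longleftrightarrow> w \<in> g -` A \<inter> space M"
      using eq by eventually_elim auto
    show "f -` A \<inter> space M \<in> sets M" using f A by (rule measurable_sets)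
  qed simp
qed simp

text \<open>Jensen's inequality has no factor \<open>2\<close>; with it, \<open>u powr c \<le> 1 + u\<close> suffices.\<close>

lemma (in prob_space) moment_powr_le:
  fixes Z :: "'a \<Rightarrow> real"
  assumes Z: "integrable M Z" "\<And>w. 0 \<le> Z w" and m: "expectation Z \<le> m" "0 < m" and c: "0 < c" "c \<le> 1"
  shows "integrable M (\<lambda>w. Z w powr c)" and "expectation (\<lambda>w. Z w powr c) \<le> 2 * m powr c"
proof -
  have le: "Z w powr c \<le> m powr c * (1 + Z w / m)" for w
  proof -
    have z: "0 \<le> Z w / m" using Z m by simp
    have "(Z w / m) powr c \<le> 1 + Z w / m"
    proof (cases "Z w / m \<le> 1")
      case True
      then have "(Z w / m) powr c \<le> 1" using powr_mono2[of c "Z w / m" 1] z c by simp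
      then show ?thesis using z by linarith
    next
      case False
      then have "(Z w / m) powr c \<le> Z w / m" using powr_mono[of c 1 "Z w / m"] c by simp
      then show ?thesis by linarith
    qed
    then have "m powr c * (Z w / m) powr c \<le> m powr c * (1 + Z w / m)"
      by (intro mult_left_mono) auto
    then show ?thesis using m Z by (simp add: powr_divide)
  qed
  have i: "integrable M (\<lambda>w. m powr c * (1 + Z w / m))" using Z by simp
  show I: "integrable M (\<lambda>w. Z w powr c)"
  proof (rule Bochner_Integration.integrable_bound[OF i])
    show "(\<lambda>w. Z w powr c) \<in> borel_measurable M" using Z(1) by measurable
    show "AE w in M. norm (Z w powr c) \<le> norm (m powr c * (1 + Z w / m))"
      using le by (intro AE_I2) (auto intro: order_trans[OF _ abs_ge_self])
  qed
  have "expectation (\<lambda>w. Z w powr c) \<le> expectation (\<lambda>w. m powr c * (1 + Z w / m))"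
    by (rule integral_mono[OF I i le])
  also have "\<dots> = m powr c * (1 + expectation Z / m)" using Z by (simp add: prob_space)
  also have "\<dots> \<le> m powr c * 2" using m by (intro mult_left_mono) auto
  finally show "expectation (\<lambda>w. Z w powr c) \<le> 2 * m powr c" by simp
qed

lemma powr_add2_le:
  fixes a b p :: real
  assumes "0 \<le> a" "0 \<le> b" "0 < p"
  shows "(a + b) powr p \<le> 2 powr p * (a powr p + b powr p)"
proof -
  have "0 \<le> [a, b] ! i" if "i \<in> {..<2}" for i
    using that assms by (auto simp: less_Suc_eq numeral_eq_Suc)
  from powr_sum_le[where A = "{..<2}" and a = "\<lambda>i. [a, b] ! i" and p = p, OF _ this] assms show ?thesis
    by (simp add: lessThan_nat_numeral lessThan_Suc add_ac)
qed

lemma powr_add5_le: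
  fixes a b c d e p :: real
  assumes "0 \<le> a" "0 \<le> b" "0 \<le> c" "0 \<le> d" "0 \<le> e" "0 < p"
  shows "(a + b + c + d + e) powr p \<le> 5 powr p * (a powr p + b powr p + c powr p + d powr p + e powr p)"
proof -
  have "0 \<le> [a, b, c, d, e] ! i" if "i \<in> {..<5}" for i
    using that assms by (auto simp: less_Suc_eq numeral_eq_Suc)
  from powr_sum_le[where A = "{..<5}" and a = "\<lambda>i. [a, b, c, d, e] ! i" and p = p, OF _ this] assms show ?thesis
    by (simp add: lessThan_nat_numeral lessThan_Suc add_ac)
qed

lemma integral_uniform_unit_interval:
  fixes F :: "real \<Rightarrow> 'b::euclidean_space"
  assumes "continuous_on UNIV F"
  shows "integral\<^sup>L (uniform_measure lborel {0<..<1}) F = integral {0..1} F"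
proof -
  have F: "F \<in> borel_measurable lborel"
    using borel_measurable_continuous_onI[OF assms] by simp
  have "uniform_measure lborel {0<..<1} = density lborel (\<lambda>u. ennreal (indicator {0<..<1::real} u))"
    unfolding uniform_measure_def by (intro arg_cong[where f = "density lborel"]) (auto simp: fun_eq_iff indicator_def)
  then have "integral\<^sup>L (uniform_measure lborel {0<..<1}) F = (LINT u:{0<..<1}|lborel. F u)"
    using integral_density[OF F, of "indicator {0<..<1}"] by (simp add: set_lebesgue_integral_def)
  also have "\<dots> = integral {0<..<1} F"
  proof (rule set_borel_integral_eq_integral)
    have "set_integrable lborel {0..1} F"
      using assms by (intro borel_integrable_compact[unfolded set_integrable_def[symmetric]] continuous_on_subset[OF assms]) auto
    then show "set_integrable lborel {0<..<1} F"
      by (rule set_integrable_subset) auto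
  qed
  finally show ?thesis by (simp add: integral_open_interval_real)
qed

text \<open>The scheme reads only nodes with positive subscript. Almost sure equality of these nodes
  thus carries over to the whole output when the truncated family replaces the given one.\<close>

lemma rk_shifted_cong:
  assumes "\<And>j k. g j (Suc k) = g' j (Suc k)"
  shows "rk_shifted f \<phi> \<tau> N g J k = rk_shifted f \<phi> \<tau> N g' J k"
proof (induction J arbitrary: k rule: less_induct)
  case (less J)
  show ?case
  proof (cases J)
    case (Suc j)
    show ?thesis unfolding Suc
    proof (induction k)
      case 0
      then show ?case using less.IH Suc by simp
    next
      case (Suc k)
      then show ?case using less.IH \<open>J = Suc j\<close> assms by (cases j) (simp_all add: Let_def)
    qed
  qed simp
qed

section \<open>Truncated nodes and measurability of the scheme\<close>

locale randomized_dde = dde_holder n \<tau> \<alpha> \<gamma> L f \<phi> x + prob_space M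
  for n :: nat and \<tau> \<alpha> \<gamma> L :: real
    and f :: "real \<Rightarrow> 'a \<Rightarrow> 'a \<Rightarrow> 'a::euclidean_space" and \<phi> x :: "real \<Rightarrow> 'a" and M :: "'w measure" +
  fixes \<gamma>s :: "nat \<Rightarrow> nat \<Rightarrow> 'w \<Rightarrow> real" and p :: real
  assumes complete_M: "complete_measure M" and iid: "iid_uniform_family M \<gamma>s" and p: "2 \<le> p"
begin

text \<open>Truncating to \<open>[0,1]\<close> changes each \<open>\<gamma>\<^sub>k\<^sup>j\<close> only on a null set, but keeps every evaluation of \<open>f\<close>
  and \<open>\<phi>\<close> inside its domain, where the function is continuous.\<close>

definition U :: "nat \<Rightarrow> nat \<Rightarrow> 'w \<Rightarrow> real" where "U j k w = max 0 (min 1 (\<gamma>s j k w))"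

lemma U_unit: "U j k w \<in> {0..1}" by (simp add: U_def)

lemma gamma_measurable: "\<gamma>s j (Suc k) \<in> borel_measurable M"
  using iid unfolding iid_uniform_family_def indep_vars_def by force

lemma U_measurable [measurable]: "U j (Suc k) \<in> borel_measurable M"
  using gamma_measurable[of j k] unfolding U_def[abs_def] by measurable

lemma AE_U_eq: "AE w in M. \<forall>j k. \<gamma>s j (Suc k) w = U j (Suc k) w"
proof -
  have "AE w in M. \<gamma>s j (Suc k) w \<in> {0<..<1}" for j k
  proof (rule AE_distrD[where M' = lborel])
    show "\<gamma>s j (Suc k) \<in> measurable M lborel" using gamma_measurable by simp
    have "distr M lborel (\<gamma>s j (Suc k)) = uniform_measure lborel {0<..<1}"
      using iid by (auto simp: iid_uniform_family_def)
    then show "AE u in distr M lborel (\<gamma>s j (Suc k)). u \<in> {0<..<1}"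
      by (simp only:) (rule AE_uniform_measureI, auto)
  qed
  then have "AE w in M. \<forall>j k. \<gamma>s j (Suc k) w \<in> {0<..<1}"
    by (simp add: AE_all_countable)
  then show ?thesis by eventually_elim (simp add: U_def min_absorb2 max_absorb2 less_imp_le)
qed

lemma f_comp_measurable:
  assumes "t \<in> borel_measurable M" "u \<in> borel_measurable M" "z \<in> borel_measurable M"
    and "\<And>w. w \<in> space M \<Longrightarrow> t w \<in> {0..T}"
  shows "(\<lambda>w. f (t w) (u w) (z w)) \<in> borel_measurable M"
proof -
  have "(\<lambda>w. (t w, u w, z w)) \<in> measurable M (restrict_space borel ({0..T} \<times> UNIV))"
    using assms by (intro measurable_restrict_space2) (auto simp: borel_measurable_Pair)
  from measurable_comp[OF this borel_measurable_continuous_on_restrict[OF f_continuous]]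
  show ?thesis by (simp add: comp_def)
qed

lemma phi_comp_measurable:
  assumes "t \<in> borel_measurable M" and "\<And>w. w \<in> space M \<Longrightarrow> t w \<in> {-\<tau>..0}"
  shows "(\<lambda>w. \<phi> (t w)) \<in> borel_measurable M"
proof -
  have "t \<in> measurable M (restrict_space borel {-\<tau>..0})"
    using assms by (intro measurable_restrict_space2) auto
  from measurable_comp[OF this borel_measurable_continuous_on_restrict[OF phi_continuous]]
  show ?thesis by (simp add: comp_def)
qed

lemma tgrid_stage_bounds:
  assumes "j \<le> n" "k < N" "u \<in> {0..1}"
  shows "tgrid \<tau> N (int j) k + \<tau> / real N * u \<in> {0..T}"
proof -
  have h: "0 \<le> \<tau> / real N" using tau by simp
  have "\<tau> / real N * u \<le> \<tau> / real N" using assms mult_left_mono[of u 1 "\<tau> / real N"] h by simp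
  moreover have "0 \<le> \<tau> / real N * u" using assms h by (intro mult_nonneg_nonneg) auto
  ultimately show ?thesis
    using tgrid_bounds[of j k N] tgrid_bounds[of j "Suc k" N] assms
    unfolding tgrid_Suc atLeastAtMost_iff by linarith
qed

lemma rk_measurable:
  assumes N: "0 < N"
  shows "J \<le> Suc n \<Longrightarrow> k \<le> N \<Longrightarrow> (\<lambda>w. rk_shifted f \<phi> \<tau> N (\<lambda>l k. U l k w) J k) \<in> borel_measurable M"
proof (induction J arbitrary: k rule: less_induct)
  case (less J)
  note IH = less.IH
  show ?case
  proof (cases J)
    case 0
    then show ?thesis by simp
  next
    case (Suc j)
    have j: "j \<le> n" using Suc less.prems by simp
    show ?thesis using less.prems(2)
    proof (induction k)
      case 0
      then show ?case using IH[of j N] Suc j by simp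
    next
      case (Suc k)
      note k = \<open>Suc k \<le> N\<close>
      have y: "(\<lambda>w. rk_shifted f \<phi> \<tau> N (\<lambda>l k. U l k w) (Suc j) k) \<in> borel_measurable M"
        using Suc \<open>J = Suc j\<close> by simp
      have z: "(\<lambda>w. rk_shifted f \<phi> \<tau> N (\<lambda>l k. U l k w) j k) \<in> borel_measurable M"
        using IH[of j k] \<open>J = Suc j\<close> j k by simp
      have t: "tgrid \<tau> N (int l) k \<in> {0..T}" if "l \<le> n" for l
        using tgrid_bounds[OF that, of k N] k N by simp
      have th: "tgrid \<tau> N (int j) k + \<tau> / real N * U j (Suc k) w \<in> {0..T}" for w
        using tgrid_stage_bounds[OF j, of k N] k U_unit by simp
      show ?case
      proof (cases j)
        case 0
        have s: "tgrid \<tau> N (- 1) k + \<tau> / real N * U 0 (Suc k) w \<in> {-\<tau>..0}" for w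
        proof -
          have "(real k + U 0 (Suc k) w) * (\<tau> / real N) \<le> real N * (\<tau> / real N)"
            using k tau U_unit[of 0 "Suc k" w] by (intro mult_right_mono) auto
          moreover have "0 \<le> (real k + U 0 (Suc k) w) * (\<tau> / real N)"
            using tau U_unit[of 0 "Suc k" w] by (intro mult_nonneg_nonneg) auto
          moreover have "tgrid \<tau> N (- 1) k + \<tau> / real N * U 0 (Suc k) w = - \<tau> + (real k + U 0 (Suc k) w) * (\<tau> / real N)"
            by (simp add: tgrid_def add_divide_distrib algebra_simps)
          moreover have "real N * (\<tau> / real N) = \<tau>" using N by simp
          ultimately show ?thesis unfolding atLeastAtMost_iff by linarith
        qed
        show ?thesis
          unfolding \<open>J = Suc j\<close> 0 rk_shifted.simps Let_def
          using y z t[of 0] th s j unfolding 0 of_nat_0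
          by (intro borel_measurable_add borel_measurable_scaleR f_comp_measurable phi_comp_measurable
              borel_measurable_times borel_measurable_const U_measurable) auto
      next
        case (Suc i)
        have v: "(\<lambda>w. rk_shifted f \<phi> \<tau> N (\<lambda>l k. U l k w) i k) \<in> borel_measurable M"
          using IH[of i k] \<open>J = Suc j\<close> Suc j k by simp
        have i: "int (Suc i) - 1 = int i" by simp
        show ?thesis
          unfolding \<open>J = Suc j\<close> Suc rk_shifted.simps Let_def i
          using y z v t[of i] t[of j] th j unfolding Suc
          by (intro borel_measurable_add borel_measurable_scaleR f_comp_measurable
              borel_measurable_times borel_measurable_const U_measurable) auto
      qed
    qed
  qed
qed

lemma rk_err_measurable:
  assumes "0 < N" "J \<le> Suc n"
  shows "(\<lambda>w. rk_err N (\<lambda>l k. U l k w) J) \<in> borel_measurable M"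
  unfolding rk_err_def
  by (intro borel_measurable_Max measurable_compose[OF _ borel_measurable_norm]
      borel_measurable_diff borel_measurable_const rk_measurable) (use assms in auto)

lemma AE_rk_err_eq: "AE w in M. rk_err N (\<lambda>l k. U l k w) J = rk_err N (\<lambda>l k. \<gamma>s l k w) J"
  using AE_U_eq
proof eventually_elim
  case (elim w)
  then have "rk_shifted f \<phi> \<tau> N (\<lambda>l k. U l k w) J i = rk_shifted f \<phi> \<tau> N (\<lambda>l k. \<gamma>s l k w) J i" for i
    by (intro rk_shifted_cong) simp
  then show ?case by (simp add: rk_err_def)
qed

section \<open>Mean, independence and moments of the quadrature errors\<close>

lemma xdot_stage_continuous:
  assumes "j \<le> n" "k < N"
  shows "continuous_on UNIV (\<lambda>u. xdot (tgrid \<tau> N (int j) k + \<tau> / real N * max 0 (min 1 u)))"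
proof (rule continuous_on_compose2[OF xdot_continuous])
  show "continuous_on UNIV (\<lambda>u. tgrid \<tau> N (int j) k + \<tau> / real N * max 0 (min 1 u))"
    by (intro continuous_intros)
  show "range (\<lambda>u. tgrid \<tau> N (int j) k + \<tau> / real N * max 0 (min 1 u)) \<subseteq> {0..T}"
    by (intro image_subsetI tgrid_stage_bounds[OF assms]) simp
qed

text \<open>A uniform node makes the one-point rule unbiased: the mean of \<open>xdot\<close> at the
  node is its average over the step, which is the increment of x divided by the step size.\<close>

lemma expectation_quad_err:
  assumes N: "0 < N" and j: "j \<le> n" and k: "k < N"
  shows "expectation (\<lambda>w. quad_err N (\<lambda>k. U j k w) j k) = 0"
proof -
  let ?h = "\<tau> / real N" and ?t = "tgrid \<tau> N (int j) k"
  have h: "0 < ?h" using tau N by simp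
  let ?F = "\<lambda>u. xdot (?t + ?h * max 0 (min 1 u))"
  have Fc: "continuous_on UNIV ?F" by (rule xdot_stage_continuous[OF j k])
  have Fm: "?F \<in> borel_measurable lborel" using borel_measurable_continuous_onI[OF Fc] by simp
  have "expectation (\<lambda>w. ?F (\<gamma>s j (Suc k) w)) = integral\<^sup>L (distr M lborel (\<gamma>s j (Suc k))) ?F"
    using gamma_measurable Fm by (subst integral_distr) auto
  also have "\<dots> = integral\<^sup>L (uniform_measure lborel {0<..<1}) ?F"
    using iid by (auto simp: iid_uniform_family_def)
  also have "\<dots> = integral {0..1} ?F" by (rule integral_uniform_unit_interval[OF Fc])
  \<comment> \<open>The antiderivative is x along the step, rescaled to the unit interval; on [0,1]
    the truncation in \<open>?F\<close> is the identity.\<close>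
  also have "\<dots> = (1 / ?h) *\<^sub>R x (?t + ?h * 1) - (1 / ?h) *\<^sub>R x (?t + ?h * 0)"
  proof (rule integral_unique, rule fundamental_theorem_of_calculus)
    fix u :: real assume u: "u \<in> {0..1}"
    have sub: "(\<lambda>u. ?t + ?h * u) ` {0..1} \<subseteq> {0..T}" using tgrid_stage_bounds[OF j k] by blast
    have 1: "((\<lambda>u. ?t + ?h * u) has_vector_derivative ?h) (at u within {0..1})"
      unfolding has_real_derivative_iff_has_vector_derivative[symmetric]
      using N by (auto intro!: derivative_eq_intros)
    have 2: "(x has_vector_derivative xdot (?t + ?h * u)) (at (?t + ?h * u) within (\<lambda>u. ?t + ?h * u) ` {0..1})"
      by (rule has_vector_derivative_within_subset[OF x_has_vector_derivative[OF tgrid_stage_bounds[OF j k u]] sub])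
    have "((\<lambda>u. x (?t + ?h * u)) has_vector_derivative ?h *\<^sub>R xdot (?t + ?h * u)) (at u within {0..1})"
      using vector_diff_chain_within[OF 1 2] by (simp add: comp_def)
    then have D: "((\<lambda>u. (1 / ?h) *\<^sub>R x (?t + ?h * u)) has_vector_derivative (1 / ?h) *\<^sub>R ?h *\<^sub>R xdot (?t + ?h * u)) (at u within {0..1})"
      by (rule bounded_linear.has_vector_derivative[OF bounded_linear_scaleR_right])
    have "(1 / ?h) *\<^sub>R ?h *\<^sub>R xdot (?t + ?h * u) = ?F u"
      using u tau N by simp
    with D show "((\<lambda>u. (1 / ?h) *\<^sub>R x (?t + ?h * u)) has_vector_derivative ?F u) (at u within {0..1})"
      by (simp only:)
  qed simp
  finally have E: "expectation (\<lambda>w. ?F (\<gamma>s j (Suc k) w)) = (1 / ?h) *\<^sub>R (x (tgrid \<tau> N (int j) (Suc k)) - x ?t)"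
    by (simp add: tgrid_Suc scaleR_diff_right)
  obtain G where "\<And>t. t \<in> {0..T} \<Longrightarrow> norm (xdot t) \<le> G" by (rule xdot_bounded) blast
  then have "integrable M (\<lambda>w. ?F (\<gamma>s j (Suc k) w))"
    using measurable_compose[OF gamma_measurable borel_measurable_continuous_onI[OF Fc]] tgrid_stage_bounds[OF j k]
    by (intro integrable_const_bound[where B = G]) auto
  then have "expectation (\<lambda>w. (x (tgrid \<tau> N (int j) (Suc k)) - x ?t) - ?h *\<^sub>R ?F (\<gamma>s j (Suc k) w))
      = (x (tgrid \<tau> N (int j) (Suc k)) - x ?t) - ?h *\<^sub>R ((1 / ?h) *\<^sub>R (x (tgrid \<tau> N (int j) (Suc k)) - x ?t))"
    using E by (simp add: prob_space)
  also have "\<dots> = 0" using tau N by simp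
  finally show ?thesis by (simp add: quad_err_def U_def)
qed

text \<open>The i-th error is a Borel function of the single variable with index
  \<open>(j, Suc i)\<close>, and these one-element index blocks are disjoint. The truncation is
  absorbed into that function, so the independence of the given family can be used directly.\<close>

lemma indep_quad_err:
  assumes j: "j \<le> n"
  shows "indep_vars (\<lambda>_. borel) (\<lambda>i w. quad_err N (\<lambda>k. U j k w) j i) {..<N}"
proof -
  let ?K = "\<lambda>i. {(j, Suc i)}"
  have "indep_vars (\<lambda>_. borel) (\<lambda>(j, k). \<gamma>s j k) (UNIV \<times> {1..})"
    using iid by (simp add: iid_uniform_family_def)
  then have "indep_vars (\<lambda>i. PiM (?K i) (\<lambda>_. borel)) (\<lambda>i w. restrict (\<lambda>l. (case l of (j, k) \<Rightarrow> \<gamma>s j k) w) (?K i)) {..<N}"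
    by (rule indep_vars_restrict) (auto simp: disjoint_family_on_def)
  then have "indep_vars (\<lambda>_. borel) (\<lambda>i w. (\<lambda>v. x (tgrid \<tau> N (int j) (Suc i)) - x (tgrid \<tau> N (int j) i)
    - (\<tau> / real N) *\<^sub>R xdot (tgrid \<tau> N (int j) i + \<tau> / real N * max 0 (min 1 (v (j, Suc i)))))
      (restrict (\<lambda>l. (case l of (j, k) \<Rightarrow> \<gamma>s j k) w) (?K i))) {..<N}"
  proof (rule indep_vars_compose2)
    fix i assume "i \<in> {..<N}"
    then have "(\<lambda>u. xdot (tgrid \<tau> N (int j) i + \<tau> / real N * max 0 (min 1 u))) \<in> borel_measurable borel"
      using xdot_stage_continuous[OF j] by (intro borel_measurable_continuous_onI) auto
    moreover have "(\<lambda>v. v (j, Suc i)) \<in> borel_measurable (PiM (?K i) (\<lambda>_. borel :: real measure))"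
      by measurable
    ultimately have "(\<lambda>v. xdot (tgrid \<tau> N (int j) i + \<tau> / real N * max 0 (min 1 (v (j, Suc i)))))
        \<in> borel_measurable (PiM (?K i) (\<lambda>_. borel :: real measure))"
      by (rule measurable_compose[rotated])
    then show "(\<lambda>v. x (tgrid \<tau> N (int j) (Suc i)) - x (tgrid \<tau> N (int j) i)
        - (\<tau> / real N) *\<^sub>R xdot (tgrid \<tau> N (int j) i + \<tau> / real N * max 0 (min 1 (v (j, Suc i)))))
        \<in> borel_measurable (PiM (?K i) (\<lambda>_. borel))"
      by (intro borel_measurable_diff borel_measurable_scaleR borel_measurable_const)
  qed
  then show ?thesis by (simp add: quad_err_def U_def)
qed

text \<open>With c = H h^(1+\<mu>) and sqrt N = sqrt(\<tau> / h), the scale c * sqrt N of the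
  partial sums is H sqrt \<tau> h^(1/2+\<mu>): the sum of N errors loses only half a power of
  h.\<close>

lemma moment_quad_err:
  obtains D where "0 < D"
    "\<And>N j. \<tau> \<le> real N \<Longrightarrow> j \<le> n \<Longrightarrow> integrable M (\<lambda>w. max_quad_err N (\<lambda>k. U j k w) j powr p)"
    "\<And>N j. \<tau> \<le> real N \<Longrightarrow> j \<le> n \<Longrightarrow>
      expectation (\<lambda>w. max_quad_err N (\<lambda>k. U j k w) j powr p) \<le> D * (\<tau> / real N) powr ((1 / 2 + \<mu>) * p)"
proof -
  obtain H where H0: "0 < H" and H2: "\<And>s t. s \<in> {0..T} \<Longrightarrow> t \<in> {0..T} \<Longrightarrow> \<bar>t - s\<bar> \<le> 1 \<Longrightarrow>
    norm (xdot t - xdot s) \<le> H * \<bar>t - s\<bar> powr \<mu>" by (rule xdot_holder) blast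
  define D0 where "D0 = DIM('a) powr p * DIM('a) * 8 * exp (1 / 2) * p powr p"
  define D where "D = D0 * (H * sqrt \<tau>) powr p"
  have p0: "0 < p" using p by simp
  have "0 < D" using H0 tau p0 by (simp add: D_def D0_def)
  have *: "integrable M (\<lambda>w. max_quad_err N (\<lambda>k. U j k w) j powr p) \<and>
      expectation (\<lambda>w. max_quad_err N (\<lambda>k. U j k w) j powr p) \<le> D * (\<tau> / real N) powr ((1 / 2 + \<mu>) * p)"
    if N: "\<tau> \<le> real N" and j: "j \<le> n" for N j
  proof -
    have N0: "0 < N" using N tau by (cases N) auto
    define h where "h = \<tau> / real N"
    have h: "0 < h" "h \<le> 1" using N N0 tau by (auto simp: h_def)
    let ?c = "H * h powr (1 + \<mu>)"
    have c: "0 < ?c" using H0 h by simp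
    have bd: "norm (quad_err N (\<lambda>k. U j k w) j i) \<le> ?c" if i: "i < N" for i w
    proof -
      have "tgrid \<tau> N (int j) i + h * U j (Suc i) w \<in> {tgrid \<tau> N (int j) i..tgrid \<tau> N (int j) i + h}"
        using U_unit[of j "Suc i" w] h by (auto simp: mult_left_le)
      then show ?thesis
        using xdot_taylor[OF less_imp_le[OF H0] H2, of "tgrid \<tau> N (int j) i" h]
          tgrid_bounds[OF j, of i N] tgrid_bounds[OF j, of "Suc i" N] i N0 h
        unfolding quad_err_def tgrid_Suc h_def[symmetric] by simp
    qed
    have cN: "?c * sqrt N = H * sqrt \<tau> * h powr (1 / 2 + \<mu>)"
    proof -
      have "real N = \<tau> / h" using N0 tau by (simp add: h_def)
      then have "sqrt N = sqrt \<tau> / h powr (1 / 2)" using h by (simp add: real_sqrt_divide powr_half_sqrt)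
      moreover have "h powr (1 + \<mu>) = h powr (1 / 2 + \<mu>) * h powr (1 / 2)" by (simp flip: powr_add)
      ultimately show ?thesis using h by simp
    qed
    have "D0 * (?c * sqrt N) powr p = D * h powr ((1 / 2 + \<mu>) * p)"
      unfolding cN using H0 tau h by (simp add: D_def powr_mult powr_powr)
    then show ?thesis
      using moment_max_norm_partial_sums[OF indep_quad_err[OF j] N0 c p0 bd expectation_quad_err[OF N0 j]]
      by (simp add: max_quad_err_def D0_def h_def)
  qed
  show thesis by (rule that[OF \<open>0 < D\<close>]) (use * in auto)
qed

section \<open>Induction over the intervals\<close>

text \<open>Convergence order on the \<open>J\<close>-th interval. The value \<open>\<rho> / \<alpha>\<close> at \<open>J = 0\<close> makes
  \<open>\<kappa> (Suc J) = \<alpha> * \<kappa> J\<close> hold for all \<open>J\<close>; there the error vanishes.\<close>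

definition \<kappa> :: "nat \<Rightarrow> real" where "\<kappa> J = \<alpha> powr (real J - 1) * (1 / 2 + \<mu>)"

lemma kappa_pos: "0 < \<kappa> J" using al mu by (simp add: \<kappa>_def)

lemma kappa_Suc: "\<kappa> (Suc J) = \<alpha> * \<kappa> J"
proof -
  have "\<alpha> powr real J = \<alpha> * \<alpha> powr (real J - 1)" using al by (simp add: powr_diff)
  then show ?thesis by (simp add: \<kappa>_def)
qed

lemma kappa_Suc_eq: "\<kappa> (Suc j) = \<alpha> ^ j * (1 / 2 + \<mu>)"
  using al by (simp add: \<kappa>_def powr_realpow)

lemma kappa_Suc_le: "\<kappa> (Suc (Suc i)) \<le> \<alpha> * (1 / 2 + \<mu>)"
proof -
  have "\<alpha> ^ Suc i \<le> \<alpha>" using al by (simp add: mult_left_le power_le_one)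
  then show ?thesis unfolding kappa_Suc_eq using mu by (intro mult_right_mono) auto
qed

text \<open>Strong induction, since the pathwise bound reaches two intervals back. From the second
  interval on, the powers \<alpha> and \<open>\<alpha>\<^sup>2\<close> of the earlier errors have
  exactly the order \<open>\<kappa> J\<close>. The quadrature term, the linear term and the
  deterministic term have at least this order, which suffices because h <= 1.\<close>

lemma moment_rk_err:
  "J \<le> Suc n \<Longrightarrow> \<exists>C>0. \<forall>N. \<tau> \<le> real N \<longrightarrow>
    integrable M (\<lambda>w. rk_err N (\<lambda>l k. U l k w) J powr p) \<and>
    expectation (\<lambda>w. rk_err N (\<lambda>l k. U l k w) J powr p) \<le> C * (\<tau> / real N) powr (\<kappa> J * p)"
proof (induction J rule: less_induct)
  case (less J)
  obtain D where D: "0 < D"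
    and D1: "\<And>N g. \<tau> \<le> real N \<Longrightarrow> (\<And>j k. g j (Suc k) \<in> {0..1}) \<Longrightarrow>
      rk_err N g (Suc 0) \<le> D * (max_quad_err N (g 0) 0 + (\<tau> / real N) powr (1 + \<mu>))"
    and D2: "\<And>N g i. \<tau> \<le> real N \<Longrightarrow> (\<And>j k. g j (Suc k) \<in> {0..1}) \<Longrightarrow> Suc i \<le> n \<Longrightarrow>
      rk_err N g (Suc (Suc i)) \<le> D * (max_quad_err N (g (Suc i)) (Suc i) + rk_err N g (Suc i)
        + rk_err N g (Suc i) powr \<alpha> + rk_err N g i powr (\<alpha>\<^sup>2) + (\<tau> / real N) powr (\<alpha> * (1 + \<mu>)))"
    by (rule pathwise_error) blast
  obtain Q where Q: "0 < Q"
    and Q1: "\<And>N j. \<tau> \<le> real N \<Longrightarrow> j \<le> n \<Longrightarrow> integrable M (\<lambda>w. max_quad_err N (\<lambda>k. U j k w) j powr p)"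
    and Q2: "\<And>N j. \<tau> \<le> real N \<Longrightarrow> j \<le> n \<Longrightarrow>
      expectation (\<lambda>w. max_quad_err N (\<lambda>k. U j k w) j powr p) \<le> Q * (\<tau> / real N) powr ((1 / 2 + \<mu>) * p)"
    by (rule moment_quad_err) blast
  let ?e = "\<lambda>N J w. rk_err N (\<lambda>l k. U l k w) J"
  let ?q = "\<lambda>N j w. max_quad_err N (\<lambda>k. U j k w) j"
  have p0: "0 < p" using p by simp
  have h: "0 < \<tau> / real N" "\<tau> / real N \<le> 1" "0 < N" if "\<tau> \<le> real N" for N
    using that tau by (cases N; auto)+
  have hmono: "(\<tau> / real N) powr a \<le> (\<tau> / real N) powr b" if "\<tau> \<le> real N" "b \<le> a" for N a b
    using h[OF that(1)] that by (intro powr_mono') auto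
  have transfer: "integrable M (\<lambda>w. ?e N J w powr p) \<and> expectation (\<lambda>w. ?e N J w powr p) \<le> B"
    if "integrable M F" "expectation F \<le> B" "\<And>w. ?e N J w powr p \<le> F w" "0 < N" for N F B
  proof -
    have m: "(\<lambda>w. ?e N J w powr p) \<in> borel_measurable M"
      using rk_err_measurable[OF that(4) less.prems] by measurable
    have i: "integrable M (\<lambda>w. ?e N J w powr p)"
      using that(3) by (intro Bochner_Integration.integrable_bound[OF that(1) m] AE_I2)
        (auto intro: order_trans[OF _ abs_ge_self])
    then show ?thesis using integral_mono[OF i that(1) that(3)] that(2) by simp
  qed
  consider "J = 0" | "J = Suc 0" | i where "J = Suc (Suc i)" by (metis not0_implies_Suc)
  then show ?case
  proof cases
    case 1
    then show ?thesis by (intro exI[of _ 1]) (auto simp: rk_err_0)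
  next
    case 2
    let ?C = "D powr p * (2 powr p * (Q + 1))"
    have "integrable M (\<lambda>w. ?e N J w powr p) \<and> expectation (\<lambda>w. ?e N J w powr p) \<le> ?C * (\<tau> / real N) powr (\<kappa> J * p)"
      if N: "\<tau> \<le> real N" for N
    proof (rule transfer)
      let ?h = "\<tau> / real N"
      let ?F = "\<lambda>w. D powr p * (2 powr p * (?q N 0 w powr p + ?h powr ((1 + \<mu>) * p)))"
      show "0 < N" using h[OF N] by simp
      show "?e N J w powr p \<le> ?F w" for w
      proof -
        have "?e N J w powr p \<le> (D * (?q N 0 w + ?h powr (1 + \<mu>))) powr p"
          unfolding 2 using D1[OF N U_unit] rk_err_nonneg p0 by (intro powr_mono2) auto
        also have "\<dots> = D powr p * (?q N 0 w + ?h powr (1 + \<mu>)) powr p"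
          using D max_quad_err_nonneg by (simp add: powr_mult)
        also have "(?q N 0 w + ?h powr (1 + \<mu>)) powr p \<le> 2 powr p * (?q N 0 w powr p + (?h powr (1 + \<mu>)) powr p)"
          using max_quad_err_nonneg p0 by (intro powr_add2_le) auto
        finally show ?thesis using D by (simp add: powr_powr)
      qed
      show "integrable M ?F" using Q1[OF N, of 0] by simp
      have "expectation ?F = D powr p * (2 powr p * (expectation (\<lambda>w. ?q N 0 w powr p) + ?h powr ((1 + \<mu>) * p)))"
        using Q1[OF N, of 0] by (simp add: prob_space)
      also have "\<dots> \<le> D powr p * (2 powr p * (Q * ?h powr ((1 / 2 + \<mu>) * p) + ?h powr ((1 / 2 + \<mu>) * p)))"
        using Q2[OF N, of 0] p0 N by (intro mult_left_mono add_mono hmono mult_right_mono) auto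
      also have "\<dots> = ?C * ?h powr (\<kappa> J * p)"
        unfolding 2 kappa_Suc_eq by (simp add: algebra_simps)
      finally show "expectation ?F \<le> ?C * ?h powr (\<kappa> J * p)" .
    qed
    moreover have "0 < ?C" using D Q by simp
    ultimately show ?thesis by blast
  next
    case (3 i)
    have i: "Suc i \<le> n" using less.prems 3 by simp
    obtain C1 where C1: "0 < C1" and C1': "\<And>N. \<tau> \<le> real N \<Longrightarrow> integrable M (\<lambda>w. ?e N (Suc i) w powr p) \<and>
        expectation (\<lambda>w. ?e N (Suc i) w powr p) \<le> C1 * (\<tau> / real N) powr (\<kappa> (Suc i) * p)"
      using less.IH[of "Suc i"] 3 i by auto
    obtain C0 where C0: "0 < C0" and C0': "\<And>N. \<tau> \<le> real N \<Longrightarrow> integrable M (\<lambda>w. ?e N i w powr p) \<and>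
        expectation (\<lambda>w. ?e N i w powr p) \<le> C0 * (\<tau> / real N) powr (\<kappa> i * p)"
      using less.IH[of i] 3 i by auto
    \<comment> \<open>\<open>D\<close> is the pathwise constant, 5 counts the summands, both factors
      2 come from \<open>moment_powr_le\<close>, and the final 1 belongs to the deterministic
      term.\<close>
    let ?C = "D powr p * (5 powr p * (Q + C1 + 2 * C1 powr \<alpha> + 2 * C0 powr (\<alpha>\<^sup>2) + 1))"
    have "integrable M (\<lambda>w. ?e N J w powr p) \<and> expectation (\<lambda>w. ?e N J w powr p) \<le> ?C * (\<tau> / real N) powr (\<kappa> J * p)"
      if N: "\<tau> \<le> real N" for N
    proof (rule transfer)
      let ?h = "\<tau> / real N"
      let ?F = "\<lambda>w. D powr p * (5 powr p * (?q N (Suc i) w powr p + ?e N (Suc i) w powr p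
        + (?e N (Suc i) w powr p) powr \<alpha> + (?e N i w powr p) powr (\<alpha>\<^sup>2) + ?h powr (\<alpha> * (1 + \<mu>) * p)))"
      show "0 < N" using h[OF N] by simp
      have al2: "0 < \<alpha>\<^sup>2" "\<alpha>\<^sup>2 \<le> 1" using al by (auto simp: power_le_one)
      have hk: "0 < C1 * ?h powr (\<kappa> (Suc i) * p)" "0 < C0 * ?h powr (\<kappa> i * p)"
        using h[OF N] C1 C0 by (auto intro!: mult_pos_pos)
      \<comment> \<open>The p-th power of \<open>e powr \<alpha>\<close> is \<open>e powr p\<close>
        raised to \<alpha>, so the known p-th moments suffice; no moments of other orders have to be
        carried through the induction.\<close>
      note A = moment_powr_le[OF conjunct1[OF C1'[OF N]] powr_ge_zero conjunct2[OF C1'[OF N]] hk(1) al]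
      note B = moment_powr_le[OF conjunct1[OF C0'[OF N]] powr_ge_zero conjunct2[OF C0'[OF N]] hk(2) al2]
      show "?e N J w powr p \<le> ?F w" for w
      proof -
        let ?X = "?q N (Suc i) w + ?e N (Suc i) w + ?e N (Suc i) w powr \<alpha> + ?e N i w powr (\<alpha>\<^sup>2) + ?h powr (\<alpha> * (1 + \<mu>))"
        have X: "0 \<le> ?X" using max_quad_err_nonneg rk_err_nonneg by (intro add_nonneg_nonneg) auto
        have "?e N J w powr p \<le> (D * ?X) powr p"
          unfolding 3 using D2[OF N U_unit i] rk_err_nonneg p0 by (intro powr_mono2) auto
        also have "\<dots> = D powr p * ?X powr p"
          using D X by (simp add: powr_mult)
        also have "?X powr p \<le> 5 powr p * (?q N (Suc i) w powr p + ?e N (Suc i) w powr p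
           + (?e N (Suc i) w powr \<alpha>) powr p + (?e N i w powr (\<alpha>\<^sup>2)) powr p + (?h powr (\<alpha> * (1 + \<mu>))) powr p)"
          using max_quad_err_nonneg rk_err_nonneg p0 by (intro powr_add5_le) auto
        finally show ?thesis using D by (simp add: powr_powr mult_ac)
      qed
      show "integrable M ?F"
        using Q1[OF N i] conjunct1[OF C1'[OF N]] A(1) B(1) by simp
      have k1: "\<kappa> J = \<alpha> * \<kappa> (Suc i)" and k2: "\<kappa> J = \<alpha>\<^sup>2 * \<kappa> i"
        unfolding 3 by (simp_all add: kappa_Suc power2_eq_square)
      have kle: "\<kappa> J \<le> \<alpha> * (1 / 2 + \<mu>)" unfolding 3 by (rule kappa_Suc_le)
      have a_le: "\<alpha> * (1 / 2 + \<mu>) \<le> 1 / 2 + \<mu>" using al mu by (intro mult_left_le_one_le) auto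
      have "expectation ?F = D powr p * (5 powr p * (expectation (\<lambda>w. ?q N (Suc i) w powr p)
        + expectation (\<lambda>w. ?e N (Suc i) w powr p)
        + expectation (\<lambda>w. (?e N (Suc i) w powr p) powr \<alpha>)
        + expectation (\<lambda>w. (?e N i w powr p) powr (\<alpha>\<^sup>2)) + ?h powr (\<alpha> * (1 + \<mu>) * p)))"
        using Q1[OF N i] conjunct1[OF C1'[OF N]] A(1) B(1) by (simp add: prob_space)
      also have "\<dots> \<le> D powr p * (5 powr p * (Q * ?h powr (\<kappa> J * p) + C1 * ?h powr (\<kappa> J * p)
        + 2 * C1 powr \<alpha> * ?h powr (\<kappa> J * p) + 2 * C0 powr (\<alpha>\<^sup>2) * ?h powr (\<kappa> J * p) + ?h powr (\<kappa> J * p)))"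
      proof (intro mult_left_mono add_mono)
        show "expectation (\<lambda>w. ?q N (Suc i) w powr p) \<le> Q * ?h powr (\<kappa> J * p)"
          using kle a_le p0 Q by (intro order_trans[OF Q2[OF N i]] mult_left_mono hmono N mult_right_mono) auto
        have "\<kappa> J \<le> \<kappa> (Suc i)" unfolding k1 using al kappa_pos[of "Suc i"] by (intro mult_left_le_one_le) auto
        then show "expectation (\<lambda>w. ?e N (Suc i) w powr p) \<le> C1 * ?h powr (\<kappa> J * p)"
          using p0 C1 by (intro order_trans[OF conjunct2[OF C1'[OF N]]] mult_left_mono hmono N mult_right_mono) auto
        have "(C1 * ?h powr (\<kappa> (Suc i) * p)) powr \<alpha> = C1 powr \<alpha> * ?h powr (\<kappa> J * p)"
          using C1 by (simp add: powr_mult powr_powr k1 mult_ac)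
        then show "expectation (\<lambda>w. (?e N (Suc i) w powr p) powr \<alpha>) \<le> 2 * C1 powr \<alpha> * ?h powr (\<kappa> J * p)"
          using A(2) by simp
        have "(C0 * ?h powr (\<kappa> i * p)) powr (\<alpha>\<^sup>2) = C0 powr (\<alpha>\<^sup>2) * ?h powr (\<kappa> J * p)"
          using C0 by (simp add: powr_mult powr_powr k2 mult_ac)
        then show "expectation (\<lambda>w. (?e N i w powr p) powr (\<alpha>\<^sup>2)) \<le> 2 * C0 powr (\<alpha>\<^sup>2) * ?h powr (\<kappa> J * p)"
          using B(2) by simp
        have "\<alpha> * (1 / 2 + \<mu>) \<le> \<alpha> * (1 + \<mu>)" using al by (intro mult_left_mono) auto
        then show "?h powr (\<alpha> * (1 + \<mu>) * p) \<le> ?h powr (\<kappa> J * p)"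
          using kle p0 by (intro hmono N mult_right_mono) auto
      qed auto
      also have "\<dots> = ?C * ?h powr (\<kappa> J * p)" by (simp add: algebra_simps)
      finally show "expectation ?F \<le> ?C * ?h powr (\<kappa> J * p)" .
    qed
    moreover have "0 < ?C" using D Q C1 C0 by (intro mult_pos_pos add_pos_pos) auto
    ultimately show ?thesis by blast
  qed
qed

lemma Lp_rk_err:
  assumes j: "j \<le> n"
  shows "\<exists>C>0. \<forall>N. \<tau> \<le> real N \<longrightarrow> in_Lp M p (\<lambda>w. rk_err N (\<lambda>l k. \<gamma>s l k w) (Suc j)) \<and>
    Lp_norm M p (\<lambda>w. rk_err N (\<lambda>l k. \<gamma>s l k w) (Suc j)) \<le> C * (\<tau> / real N) powr (\<alpha> ^ j * (1 / 2 + \<mu>))"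
proof -
  obtain C where C: "0 < C" and C': "\<And>N. \<tau> \<le> real N \<Longrightarrow>
      integrable M (\<lambda>w. rk_err N (\<lambda>l k. U l k w) (Suc j) powr p) \<and>
      expectation (\<lambda>w. rk_err N (\<lambda>l k. U l k w) (Suc j) powr p) \<le> C * (\<tau> / real N) powr (\<kappa> (Suc j) * p)"
    using moment_rk_err[of "Suc j"] j by auto
  have "in_Lp M p (\<lambda>w. rk_err N (\<lambda>l k. \<gamma>s l k w) (Suc j)) \<and>
    Lp_norm M p (\<lambda>w. rk_err N (\<lambda>l k. \<gamma>s l k w) (Suc j)) \<le> C powr (1 / p) * (\<tau> / real N) powr (\<alpha> ^ j * (1 / 2 + \<mu>))"
    if N: "\<tau> \<le> real N" for N
  proof -
    have N0: "0 < N" using N tau by (cases N) auto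
    let ?U = "\<lambda>w. rk_err N (\<lambda>l k. U l k w) (Suc j)" and ?G = "\<lambda>w. rk_err N (\<lambda>l k. \<gamma>s l k w) (Suc j)"
    have m: "?G \<in> borel_measurable M"
      using complete_measure.borel_measurable_cong_AE[OF complete_M rk_err_measurable[OF N0] AE_rk_err_eq] j by simp
    have ae: "AE w in M. ?U w powr p = norm (?G w) powr p"
      using AE_rk_err_eq[of N "Suc j"] by eventually_elim (simp add: rk_err_nonneg)
    have mp: "(\<lambda>w. norm (?G w) powr p) \<in> borel_measurable M" using m by measurable
    have mU: "(\<lambda>w. ?U w powr p) \<in> borel_measurable M" using C'[OF N] by blast
    have i: "integrable M (\<lambda>w. norm (?G w) powr p)"
      using C'[OF N] integrable_cong_AE[OF mU mp ae] by simp
    have "Lp_norm M p ?G = expectation (\<lambda>w. ?U w powr p) powr (1 / p)"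
      unfolding Lp_norm_def using integral_cong_AE[OF mU mp ae] by simp
    also have "\<dots> \<le> (C * (\<tau> / real N) powr (\<kappa> (Suc j) * p)) powr (1 / p)"
      using C'[OF N] p by (intro powr_mono2) (auto intro!: Bochner_Integration.integral_nonneg)
    also have "\<dots> = C powr (1 / p) * (\<tau> / real N) powr (\<alpha> ^ j * (1 / 2 + \<mu>))"
      using C p by (simp add: powr_mult powr_powr kappa_Suc_eq)
    finally show ?thesis using m i by (simp add: in_Lp_def)
  qed
  moreover have "0 < C powr (1 / p)" using C by simp
  ultimately show ?thesis by blast
qed

end

theorem theorem4p3:
  fixes n :: nat and \<tau> p \<alpha> \<gamma> \<rho> Kbar L :: real
    and f :: "real \<Rightarrow> real ^ 'd \<Rightarrow> real ^ 'd \<Rightarrow> real ^ 'd"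
    and \<phi> x :: "real \<Rightarrow> real ^ 'd"
    and M :: "'w measure"
    and \<gamma>s :: "nat \<Rightarrow> nat \<Rightarrow> 'w \<Rightarrow> real"
  assumes "prob_space M" and "complete_measure M"
    and "iid_uniform_family M \<gamma>s"
    and "\<tau> > 0" and "p \<ge> 2"
    and "0 < \<alpha>" and "\<alpha> \<le> 1" and "0 < \<gamma>" and "\<gamma> \<le> 1"
    and A1_f: "\<And>t. t \<in> {0..(real n + 1) * \<tau>} \<Longrightarrow> continuous_on UNIV (\<lambda>(u, z). f t u z)"
    and A1_phi: "continuous_on {-\<tau>..0} \<phi>"
    and A2: "\<And>u z. (\<lambda>t. f t u z) \<in> borel_measurable (restrict_space borel {0..(real n + 1) * \<tau>})"
    and "Kbar \<ge> 0"
    and A3_0: "\<And>t. t \<in> {0..(real n + 1) * \<tau>} \<Longrightarrow> norm (f t 0 0) \<le> Kbar"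
    and "L \<ge> 0"
    and A3_1: "\<And>t x1 x2 z1 z2. t \<in> {0..(real n + 1) * \<tau>} \<Longrightarrow>
        norm (f t x1 z1 - f t x2 z2) \<le> L * (norm (x1 - x2) + norm (z1 - z2) powr \<alpha>)"
    and A3_2: "\<And>t1 t2 u z. t1 \<in> {0..(real n + 1) * \<tau>} \<Longrightarrow> t2 \<in> {0..(real n + 1) * \<tau>} \<Longrightarrow>
        norm (f t1 u z - f t2 u z) \<le> L * (1 + norm u + norm z) * \<bar>t1 - t2\<bar> powr \<gamma>"
    and A3_3: "\<And>s t. s \<in> {-\<tau>..0} \<Longrightarrow> t \<in> {-\<tau>..0} \<Longrightarrow> norm (\<phi> t - \<phi> s) \<le> L * \<bar>t - s\<bar>"
    and sol: "dde_solution f \<phi> \<tau> n x"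
    and rho: "\<rho> = 1 / 2 + min \<gamma> \<alpha>"
  shows "\<exists>C :: nat \<Rightarrow> real. (\<forall>j\<le>n. C j > 0) \<and>
    (\<forall>N :: nat. \<forall>j\<le>n. int N \<ge> \<lceil>\<tau>\<rceil> \<longrightarrow>
      (let err = (\<lambda>\<omega>. Max ((\<lambda>i. norm (x (tgrid \<tau> N (int j) i)
                          - rk_scheme f \<phi> \<tau> N (\<lambda>l k. \<gamma>s l k \<omega>) j i)) ` {0..N}))
       in in_Lp M p err \<and> Lp_norm M p err \<le> C j * (\<tau> / real N) powr (\<alpha> ^ j * \<rho>)))"
proof -
  interpret prob_space M by fact
  interpret randomized_dde n \<tau> \<alpha> \<gamma> L f \<phi> x M \<gamma>s p
    by (intro randomized_dde.intro dde_holder.intro randomized_dde_axioms.intro prob_space_axioms) (fact assms)+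
  have rho': "\<rho> = 1 / 2 + \<mu>" by (simp add: rho \<mu>_def)
  have err: "(\<lambda>\<omega>. Max ((\<lambda>i. norm (x (tgrid \<tau> N (int j) i)
      - rk_scheme f \<phi> \<tau> N (\<lambda>l k. \<gamma>s l k \<omega>) j i)) ` {0..N})) = (\<lambda>\<omega>. rk_err N (\<lambda>l k. \<gamma>s l k \<omega>) (Suc j))" for N j
    by (simp add: rk_err_def rk_scheme_def)
  have "\<exists>C. \<forall>j\<le>n. 0 < C j \<and> (\<forall>N. \<tau> \<le> real N \<longrightarrow>
      in_Lp M p (\<lambda>w. rk_err N (\<lambda>l k. \<gamma>s l k w) (Suc j)) \<and>
      Lp_norm M p (\<lambda>w. rk_err N (\<lambda>l k. \<gamma>s l k w) (Suc j)) \<le> C j * (\<tau> / real N) powr (\<alpha> ^ j * (1 / 2 + \<mu>)))"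
    using Lp_rk_err by metis
  \<comment> \<open>The condition on N says exactly that \<tau> <= N, that is h <= 1; it also
    excludes N = 0, as \<tau> > 0.\<close>
  then show ?thesis
    unfolding Let_def err rho' by (auto simp: ceiling_le_iff)
qed

end
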